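(* Let $\mathcal{F}$ be the family of all functions $f$ holomorphic in the unit disk $\mathbb{D}$ for which all zeros are positive real numbers and all $1$-points are negative real numbers. Then $\mathcal{F}$ is normal in $\mathbb{D}\setminus\{0\}$, and every sequence $(f_k)$ in $\mathcal{F}$ which does not have a subsequence convergent in $\mathbb{D}$ is of the form $$f_k(z)=(z-a_k)\,g_k(z),$$ where the $g_k$ are holomorphic in $\mathbb{D}$ with $g_k\to\infty$ locally uniformly in $\mathbb{D}$ and $a_k\to 0$.
   Context: $\mathbb{D}=\{z\in\mathbb{C}: |z|<1\}$. A $1$-point of $f$ is a point $z$ in the domain of $f$ with $f(z)=1$. A family of holomorphic functions is normal in an open set $U$ if every sequence in the family has a subsequence which converges locally uniformly in $U$ with respect to the spherical metric (the constant limit $\infty$ is allowed). Convergence of a sequence of holomorphic functions in $U$ is likewise understood as locally uniform convergence in $U$ with respect to the spherical metric, the constant limit $\infty$ being allowed. *)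

theory Defs
  imports "HOL-Complex_Analysis.Complex_Analysis"
begin

datatype riemann_sphere = Fin complex | Infty

text \<open>The length of the chord joining two points on the Euclidean unit sphere, in terms of
  their stereographic projections to the plane.\<close>

fun chordal_dist :: "riemann_sphere \<Rightarrow> riemann_sphere \<Rightarrow> real" where
  "chordal_dist (Fin z) (Fin w) =
     2 * norm (z - w) / (sqrt (1 + (norm z)\<^sup>2) * sqrt (1 + (norm w)\<^sup>2))"
| "chordal_dist (Fin z) Infty = 2 / sqrt (1 + (norm z)\<^sup>2)"
| "chordal_dist Infty (Fin w) = 2 / sqrt (1 + (norm w)\<^sup>2)"
| "chordal_dist Infty Infty = 0"

text \<open>The geodesic distance on the unit sphere: a chord of length \<open>c\<close> subtends an arc of
  length \<open>2 arcsin (c/2)\<close>.  It is induced by the line element \<open>2|dz| / (1 + |z|^2)\<close>.\<close>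

definition spherical_dist :: "riemann_sphere \<Rightarrow> riemann_sphere \<Rightarrow> real" where
  "spherical_dist p q = 2 * arcsin (chordal_dist p q / 2)"

text \<open>Locally uniform convergence on an open set \<open>U\<close>, i.e. uniform convergence on its compact
  subsets.  The limit may take the value \<open>Infty\<close>; for holomorphic functions on a connected \<open>U\<close>
  it is then the constant \<open>Infty\<close>.  Only the values on \<open>U\<close> matter.\<close>

definition spherically_converges_on ::
    "complex set \<Rightarrow> (nat \<Rightarrow> complex \<Rightarrow> complex) \<Rightarrow> (complex \<Rightarrow> riemann_sphere) \<Rightarrow> bool" where
  "spherically_converges_on U f l \<longleftrightarrow>
     (\<forall>K. compact K \<and> K \<subseteq> U \<longrightarrow>
       uniform_limit K (\<lambda>n z. spherical_dist (Fin (f n z)) (l z)) (\<lambda>_. 0) sequentially)"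

definition has_convergent_subseq_on :: "complex set \<Rightarrow> (nat \<Rightarrow> complex \<Rightarrow> complex) \<Rightarrow> bool" where
  "has_convergent_subseq_on U f \<longleftrightarrow>
     (\<exists>r l. strict_mono (r :: nat \<Rightarrow> nat) \<and> spherically_converges_on U (f \<circ> r) l)"

definition normal_on :: "complex set \<Rightarrow> (complex \<Rightarrow> complex) set \<Rightarrow> bool" where
  "normal_on U F \<longleftrightarrow> (\<forall>f :: nat \<Rightarrow> complex \<Rightarrow> complex. range f \<subseteq> F \<longrightarrow> has_convergent_subseq_on U f)"

definition radial_family :: "(complex \<Rightarrow> complex) set" where
  "radial_family = {f. f holomorphic_on ball 0 1 \<and>
     (\<forall>z \<in> ball 0 1. f z = 0 \<longrightarrow> z \<in> \<real> \<and> Re z > 0) \<and>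
     (\<forall>z \<in> ball 0 1. f z = 1 \<longrightarrow> z \<in> \<real> \<and> Re z < 0)}"

end

(*
  On the slit disc U = D - [0,1) a member f of the family has no zeros, on D - (-1,0] the function
  1 - f has no zeros, and off the real axis f omits 0 and 1.  Schottky's theorem, applied to m-th
  roots of f, gives a Harnack inequality for 1 + |ln |f||, hence polynomial growth of f'/f towards
  the real axis; since f'/f is holomorphic across (-1,0), its locally uniform size on U is controlled
  by the values of ln |f| at i/2 and -i/2 alone.  So a suitable subsequence either stays bounded, or
  ln |f_k| and ln |1 - f_k|, divided by a common factor A_k tending to infinity, converge to harmonic
  functions u on U and v on D - (-1,0].  In the upper and in the lower half disc u = v >= 0, or one
  of u, v vanishes and the other is <= 0; as each of them extends harmonically across one of the two
  radii, only u = v > 0 survives when f_k and 1 - f_k are both unbounded, and then f_k tends to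
  infinity off 0.

  If f_k tends to infinity off 0, let -y be a 1-point of g = 1 - f_k(-z), that is, let y be a zero
  of f_k.  Writing g = P h with a polynomial P having the zeros of g, the term P'/P dominates h'/h on
  the segment from -y to 0, so that |g(-t)| is strictly increasing on [0,y].  Hence y is the only
  zero of f_k near 0, and it is simple.
*)

theory Submission
  imports Defs
begin

subsection \<open>Functions omitting 0 and 1\<close>

text \<open>Schottky's bound is doubly exponential in the value at the centre. An m-th root with m
  about |ln |f|| has modulus at most e there and still omits 0 and 1, so the bound for ln |f|
  becomes linear, and only a linear bound survives division by a common factor. A member f has its
  1-points on (-1,0), so estimates for functions omitting 0 and 1 do not cross that radius. Crossing
  it by way of f'/f is what lets maximum principles pass from one half disc to the other. The common
  factor is the sum of the sizes of f and of 1 - f(-z) at the base points. If both sizes tend to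
  infinity, the four normalized logarithms there have absolute values with sum 1 in the limit, so u
  and v cannot both be trivial. Where u = 0, the limit v is not determined by u; hence v is a second
  unknown. The origin lies on both slits and needs its own argument: 1/2 - k z belongs to the
  family, and its zero and 1-point merge at 0. Zeros are the only obstruction to divergence across
  0, by the minimum principle. The size of h is accessible at the 1-point of g because |P| |h| = 1
  there.\<close>

definition log_size :: "complex \<Rightarrow> real" where
  "log_size w = 1 + \<bar>ln (norm w)\<bar>"

text \<open>The summand 1 lets additive errors be absorbed, so that all estimates are pure multiples
  of \<open>log_size (f w)\<close>, even when |f w| = 1.\<close>

lemma log_size_ge_1: "1 \<le> log_size w"
  by (simp add: log_size_def)

lemma log_size_pos [simp]: "0 < log_size w" "0 \<le> log_size w"
  using log_size_ge_1 [of w] by linarith+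

text \<open>Schottky's theorem for an m-th root \<open>g\<close> of \<open>f\<close>: ln |f| = m ln
  |g|, and m is comparable with \<open>log_size (f w)\<close>.\<close>

lemma holomorphic_omitting_disc_upper:
  obtains c where "0 < c"
    "\<And>f w R z. \<lbrakk>0 < R; f holomorphic_on ball w R; \<And>z. z \<in> ball w R \<Longrightarrow> f z \<noteq> 0 \<and> f z \<noteq> 1;
       z \<in> cball w (3/4 * R)\<rbrakk> \<Longrightarrow> ln (norm (f z)) \<le> c * log_size (f w)"
proof
  \<comment> \<open>The exponent in Schottky's theorem for a central value of modulus at most e and
    for radius 6/7. The further factor 2 comes from rounding \<open>log_size (f w)\<close> up to an
    integer.\<close>
  let ?c = "pi * exp(pi * (2 + 2 * exp 1 + 12 * (6/7) / (1 - 6/7)))"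
  show "0 < 2 * ?c" by simp
  fix f :: "complex \<Rightarrow> complex" and w R z
  assume R: "0 < R" and holf: "f holomorphic_on ball w R"
    and om: "\<And>z. z \<in> ball w R \<Longrightarrow> f z \<noteq> 0 \<and> f z \<noteq> 1" and z: "z \<in> cball w (3/4 * R)"
  obtain L where holL: "L holomorphic_on ball w R" and L: "\<And>z. z \<in> ball w R \<Longrightarrow> f z = exp (L z)"
    using contractible_imp_holomorphic_log [OF holf convex_imp_contractible [OF convex_ball]] om by metis
  define m where "m = nat \<lceil>log_size (f w)\<rceil>"
  have m: "log_size (f w) \<le> m" "m \<le> 2 * log_size (f w)" "0 < real m"
    using log_size_ge_1 [of "f w"] by (auto simp: m_def) linarith+
  define g where "g = (\<lambda>z. exp (L z / of_nat m))"
  have gm: "g z ^ m = f z" if "z \<in> ball w R" for z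
    using m(3) L that by (simp add: g_def flip: exp_of_nat_mult)
  have holg: "g holomorphic_on ball w R"
    unfolding g_def by (intro holomorphic_intros holL) (use m in auto)
  have g01: "\<not> (g z = 0 \<or> g z = 1)" if "z \<in> ball w R" for z
    using gm [OF that] om [OF that] by (auto simp: g_def)
  \<comment> \<open>Schottky's theorem asks for the closed unit disc, so the disc is shrunk by 7/8;
    the relative radius 3/4 becomes 6/7.\<close>
  define h where "h = (\<lambda>\<zeta>. g (w + of_real (7/8 * R) * \<zeta>))"
  have in_ball: "w + of_real (7/8 * R) * \<zeta> \<in> ball w R" if "\<zeta> \<in> cball 0 1" for \<zeta> :: complex
  proof -
    have "norm \<zeta> * (7/8 * R) \<le> 1 * (7/8 * R)"
      using that R by (intro mult_right_mono) auto
    then show ?thesis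
      using R by (simp add: dist_norm norm_mult mult.commute)
  qed
  have holh: "h holomorphic_on cball 0 1"
    unfolding h_def
    by (rule holomorphic_on_compose_gen [OF _ holg, unfolded o_def])
       (use in_ball in \<open>auto intro!: holomorphic_intros simp del: mem_ball mem_cball\<close>)
  have w_in: "w \<in> ball w R" using R by simp
  have "ln (norm (f w)) = Re (L w)"
    using L [OF w_in] by simp
  then have "Re (L w) \<le> m"
    using m(1) unfolding log_size_def by linarith
  then have "norm (h 0) \<le> exp 1"
    using m(3) by (simp add: h_def g_def)
  moreover define \<zeta> where "\<zeta> = (z - w) / of_real (7/8 * R)"
  have "norm \<zeta> \<le> 6/7"
  proof -
    have "norm (z - w) \<le> 3/4 * R"
      using z by (simp add: dist_norm norm_minus_commute)
    moreover have "norm \<zeta> = norm (z - w) / (7/8 * R)"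
      unfolding \<zeta>_def norm_divide norm_of_real using R by simp
    ultimately have "norm \<zeta> \<le> (3/4 * R) / (7/8 * R)"
      using R by (simp only: divide_right_mono)
    also have "\<dots> = 6/7" using R by simp
    finally show ?thesis .
  qed
  ultimately have "norm (h \<zeta>) \<le> exp ?c"
    by (intro Schottky [OF holh]) (use g01 in_ball in \<open>auto simp: h_def\<close>)
  moreover have "h \<zeta> = g z"
  proof -
    have "complex_of_real (7/8 * R) \<noteq> 0" using R by simp
    then have "of_real (7/8 * R) * \<zeta> = z - w"
      using \<zeta>_def nonzero_eq_divide_eq by (metis mult.commute)
    then show ?thesis by (simp only: h_def) simp
  qed
  ultimately have "Re (L z) / m \<le> ?c"
    by (simp add: g_def)
  then have "Re (L z) \<le> ?c * m"
    using m(3) by (simp add: divide_le_eq)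
  also have "\<dots> \<le> ?c * (2 * log_size (f w))"
    using m(2) by (intro mult_left_mono) auto
  finally have "Re (L z) \<le> 2 * ?c * log_size (f w)"
    by (simp add: mult_ac)
  moreover have "z \<in> ball w R" using z R by auto
  ultimately show "ln (norm (f z)) \<le> 2 * ?c * log_size (f w)"
    using L by simp
qed

lemma log_size_inverse [simp]: "log_size (inverse w) = log_size w"
  by (cases "w = 0") (simp_all add: log_size_def norm_inverse ln_inverse)

text \<open>1/f omits 0 and 1 as well, which makes the upper estimate two-sided.\<close>

lemma log_size_omitting_disc:
  obtains C where "1 \<le> C"
    "\<And>f w R z. \<lbrakk>0 < R; f holomorphic_on ball w R; \<And>z. z \<in> ball w R \<Longrightarrow> f z \<noteq> 0 \<and> f z \<noteq> 1;
       z \<in> cball w (3/4 * R)\<rbrakk> \<Longrightarrow> log_size (f z) \<le> C * log_size (f w)"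
proof -
  obtain c where c: "0 < c"
    "\<And>f w R z. \<lbrakk>0 < R; f holomorphic_on ball w R; \<And>z. z \<in> ball w R \<Longrightarrow> f z \<noteq> 0 \<and> f z \<noteq> 1;
       z \<in> cball w (3/4 * R)\<rbrakk> \<Longrightarrow> ln (norm (f z)) \<le> c * log_size (f w)"
    using holomorphic_omitting_disc_upper by blast
  show thesis
  proof
    show "1 \<le> 1 + c" using c by simp
    fix f :: "complex \<Rightarrow> complex" and w R z
    assume *: "0 < R" "f holomorphic_on ball w R" "\<And>z. z \<in> ball w R \<Longrightarrow> f z \<noteq> 0 \<and> f z \<noteq> 1"
      "z \<in> cball w (3/4 * R)"
    have "ln (norm (f z)) \<le> c * log_size (f w)"
      by (rule c(2) [OF *])
    moreover have "ln (norm (inverse (f z))) \<le> c * log_size (inverse (f w))"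
      by (rule c(2) [of R "\<lambda>z. inverse (f z)" w]) (use * in \<open>auto intro!: holomorphic_intros\<close>)
    moreover have "f z \<noteq> 0" using * by auto
    ultimately have "\<bar>ln (norm (f z))\<bar> \<le> c * log_size (f w)"
      by (simp add: norm_inverse ln_inverse)
    then show "log_size (f z) \<le> (1 + c) * log_size (f w)"
      using log_size_ge_1 [of "f w"] by (simp add: log_size_def algebra_simps)
  qed
qed

text \<open>The real part of a logarithm \<open>L\<close> controls its derivative:
  \<open>E = exp (L / T)\<close> has modulus between 1/e and e, Cauchy's inequality on radius s/2
  bounds E', and L' = T E'/E.\<close>

lemma norm_deriv_div_le:
  assumes "0 < s" "f holomorphic_on ball z s" "0 < T"
    and f0: "\<And>x. x \<in> ball z s \<Longrightarrow> f x \<noteq> 0"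
    and fT: "\<And>x. x \<in> ball z s \<Longrightarrow> \<bar>ln (norm (f x))\<bar> \<le> T"
  shows "norm (deriv f z / f z) \<le> 2 * exp 2 * T / s"
proof -
  obtain L where holL: "L holomorphic_on ball z s" and L: "\<And>x. x \<in> ball z s \<Longrightarrow> f x = exp (L x)"
    using contractible_imp_holomorphic_log [OF assms(2) convex_imp_contractible [OF convex_ball]] f0
    by metis
  have ReL: "\<bar>Re (L x)\<bar> \<le> T" if "x \<in> ball z s" for x
    using fT [OF that] L [OF that] by simp
  define E where "E = (\<lambda>x. exp (L x / of_real T))"
  have holE: "E holomorphic_on ball z s"
    unfolding E_def by (intro holomorphic_intros holL) (use assms in auto)
  have z: "z \<in> ball z s" using assms by simp
  have "norm ((deriv ^^ 1) E z) \<le> fact 1 * exp 1 / (s/2) ^ 1"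
  proof (rule Cauchy_inequality)
    show "E holomorphic_on ball z (s/2)"
      by (rule holomorphic_on_subset [OF holE]) (use assms in auto)
    show "continuous_on (cball z (s/2)) E"
      by (rule holomorphic_on_imp_continuous_on, rule holomorphic_on_subset [OF holE])
         (use assms in auto)
    fix x assume x: "norm (z - x) = s/2"
    then have "x \<in> ball z s" using assms by (auto simp: dist_norm)
    from ReL [OF this] show "norm (E x) \<le> exp 1"
      using assms by (simp add: E_def divide_le_eq)
  qed (use assms in auto)
  then have E': "norm (deriv E z) \<le> 2 * exp 1 / s" by (simp add: mult.commute)
  have dL: "L field_differentiable at z"
    using holL z open_ball holomorphic_on_imp_differentiable_at by blast
  have 1: "deriv E z = deriv L z / of_real T * E z"
  proof (rule DERIV_imp_deriv)
    have "(L has_field_derivative deriv L z) (at z)"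
      using dL field_differentiable_derivI by blast
    then show "(E has_field_derivative deriv L z / of_real T * E z) (at z)"
      unfolding E_def using \<open>0 < T\<close> by (auto intro!: derivative_eq_intros)
  qed
  have 2: "deriv f z = deriv L z * f z"
  proof (rule DERIV_imp_deriv)
    have "((\<lambda>x. exp (L x)) has_field_derivative deriv L z * f z) (at z)"
      using dL field_differentiable_derivI L z by (auto intro!: derivative_eq_intros)
    then show "(f has_field_derivative deriv L z * f z) (at z)"
      by (rule has_field_derivative_transform_within_open [OF _ open_ball z]) (use L in auto)
  qed
  have "exp (- 1) \<le> norm (E z)"
    using ReL [OF z] assms by (simp add: E_def le_divide_eq)
  then have "norm (deriv L z / of_real T) * exp (- 1) \<le> norm (deriv L z / of_real T) * norm (E z)"
    by (intro mult_left_mono) auto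
  also have "\<dots> = norm (deriv E z)"
    by (simp only: 1 norm_mult)
  also note E'
  finally have "norm (deriv L z) \<le> 2 * (exp 1 * exp 1) * T / s"
    using assms by (simp add: norm_divide exp_minus field_simps)
  then show ?thesis
    using f0 [OF z] by (simp add: 2 flip: exp_add)
qed

lemma norm_deriv_div_omitting_disc:
  obtains C where "1 \<le> C"
    "\<And>f w R z. \<lbrakk>0 < R; f holomorphic_on ball w R; \<And>z. z \<in> ball w R \<Longrightarrow> f z \<noteq> 0 \<and> f z \<noteq> 1;
       z \<in> cball w (R/2)\<rbrakk> \<Longrightarrow> norm (deriv f z / f z) \<le> C * log_size (f w) / R"
proof -
  obtain C where C: "1 \<le> C"
    "\<And>f w R z. \<lbrakk>0 < R; f holomorphic_on ball w R; \<And>z. z \<in> ball w R \<Longrightarrow> f z \<noteq> 0 \<and> f z \<noteq> 1;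
       z \<in> cball w (3/4 * R)\<rbrakk> \<Longrightarrow> log_size (f z) \<le> C * log_size (f w)"
    using log_size_omitting_disc by blast
  show thesis
  proof
    have "1 \<le> exp (2::real)" by simp
    then have "1 * 1 \<le> (8 * exp 2) * C"
      using C(1) by (intro mult_mono) linarith+
    then show "1 \<le> 8 * exp 2 * C" by simp
    fix f :: "complex \<Rightarrow> complex" and w R z
    assume *: "0 < R" "f holomorphic_on ball w R" "\<And>z. z \<in> ball w R \<Longrightarrow> f z \<noteq> 0 \<and> f z \<noteq> 1"
      and z: "z \<in> cball w (R/2)"
    have sub: "x \<in> cball w (3/4 * R)" if "x \<in> ball z (R/4)" for x
      using that z dist_triangle [of w x z] by simp
    have sub': "x \<in> ball w R" if "x \<in> ball z (R/4)" for x
      using sub [OF that] \<open>0 < R\<close> by simp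
    have "norm (deriv f z / f z) \<le> 2 * exp 2 * (C * log_size (f w)) / (R/4)"
    proof (rule norm_deriv_div_le)
      show "f holomorphic_on ball z (R/4)"
        using sub' by (intro holomorphic_on_subset [OF *(2)] subsetI)
      show "0 < C * log_size (f w)"
        using C(1) by simp
      fix x assume x: "x \<in> ball z (R/4)"
      show "f x \<noteq> 0" using *(3) sub' [OF x] by blast
      have "log_size (f x) \<le> C * log_size (f w)"
        by (rule C(2) [OF * sub [OF x]])
      then show "\<bar>ln (norm (f x))\<bar> \<le> C * log_size (f w)"
        unfolding log_size_def by linarith
    qed (use * in auto)
    then show "norm (deriv f z / f z) \<le> 8 * exp 2 * C * log_size (f w) / R"
      by (simp add: field_simps)
  qed
qed

lemma compact_uniform_bound:
  fixes P :: "'a::topological_space \<Rightarrow> real \<Rightarrow> bool"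
  assumes "compact K"
    and loc: "\<And>z. z \<in> K \<Longrightarrow> \<exists>T C. open T \<and> z \<in> T \<and> (\<forall>x\<in>T \<inter> K. P x C)"
    and mono: "\<And>x C D. P x C \<Longrightarrow> C \<le> D \<Longrightarrow> P x D"
  obtains C where "1 \<le> C" "\<And>x. x \<in> K \<Longrightarrow> P x C"
proof -
  obtain T c where T: "\<And>z. z \<in> K \<Longrightarrow> open (T z) \<and> z \<in> T z \<and> (\<forall>x\<in>T z \<inter> K. P x (c z))"
    using loc by metis
  obtain F where F: "F \<subseteq> K" "finite F" "K \<subseteq> (\<Union>z\<in>F. T z)"
    using compactE_image [OF \<open>compact K\<close>, of K T] T by (metis UN_I subsetI)
  show thesis
  proof
    show "1 \<le> Max (insert 1 (c ` F))" using F by simp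
    fix x assume "x \<in> K"
    then obtain z where z: "z \<in> F" "x \<in> T z" using F by blast
    then have "P x (c z)" using T F \<open>x \<in> K\<close> by blast
    then show "P x (Max (insert 1 (c ` F)))"
      by (rule mono) (use z F in auto)
  qed
qed

text \<open>Comparability of \<open>log_size (f a)\<close> and \<open>log_size (f b)\<close> with a
  constant independent of f is an equivalence relation that holds locally, hence throughout a
  connected set. Compactness makes the constant uniform.\<close>

lemma log_size_omitting_compact:
  assumes "open S" "connected S" "w \<in> S" "compact K" "K \<subseteq> S"
  obtains C where "1 \<le> C"
    "\<And>f z. \<lbrakk>f holomorphic_on S; \<And>z. z \<in> S \<Longrightarrow> f z \<noteq> 0 \<and> f z \<noteq> 1; z \<in> K\<rbrakk>
      \<Longrightarrow> log_size (f z) \<le> C * log_size (f w)"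
proof -
  define X where "X = {f. f holomorphic_on S \<and> (\<forall>z\<in>S. f z \<noteq> 0 \<and> f z \<noteq> 1)}"
  define R where "R = (\<lambda>a b. \<exists>C\<ge>0. \<forall>f\<in>X. log_size (f a) \<le> C * log_size (f b) \<and> log_size (f b) \<le> C * log_size (f a))"
  obtain C where C: "1 \<le> C"
    "\<And>f w R z. \<lbrakk>0 < R; f holomorphic_on ball w R; \<And>z. z \<in> ball w R \<Longrightarrow> f z \<noteq> 0 \<and> f z \<noteq> 1;
       z \<in> cball w (3/4 * R)\<rbrakk> \<Longrightarrow> log_size (f z) \<le> C * log_size (f w)"
    using log_size_omitting_disc by blast
  have loc: "\<exists>e>0. \<forall>x\<in>ball a e. x \<in> S \<and> (\<forall>f\<in>X. log_size (f a) \<le> C * log_size (f x) \<and> log_size (f x) \<le> C * log_size (f a))"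
    if "a \<in> S" for a
  proof -
    obtain r where r: "r > 0" "ball a r \<subseteq> S"
      using \<open>open S\<close> \<open>a \<in> S\<close> openE by blast
    have "x \<in> S \<and> log_size (f a) \<le> C * log_size (f x) \<and> log_size (f x) \<le> C * log_size (f a)"
      if x: "x \<in> ball a (r/4)" and f: "f \<in> X" for x f
    proof -
      \<comment> \<open>The reverse estimate needs a disc about \<open>x\<close> with
        \<open>a\<close> well inside; radius 3/4 r will do because |x - a| < r/4.\<close>
      have xS: "ball x (3/4 * r) \<subseteq> S"
      proof
        fix y assume "y \<in> ball x (3/4 * r)"
        then have "y \<in> ball a r" using x dist_triangle [of a y x] by simp
        then show "y \<in> S" using r by blast
      qed
      have "log_size (f x) \<le> C * log_size (f a)"
        by (rule C(2) [of r f a x]) (use x f r in \<open>auto simp: X_def intro: holomorphic_on_subset\<close>)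
      moreover have "log_size (f a) \<le> C * log_size (f x)"
      proof (rule C(2) [of "3/4 * r" f x a])
        show "f holomorphic_on ball x (3/4 * r)"
          using f xS by (auto simp only: X_def intro: holomorphic_on_subset)
        show "f z \<noteq> 0 \<and> f z \<noteq> 1" if "z \<in> ball x (3/4 * r)" for z
          using f xS that unfolding X_def by blast
      qed (use x r in \<open>auto simp: dist_commute\<close>)
      moreover have "x \<in> S" using xS r by auto
      ultimately show ?thesis by simp
    qed
    then show ?thesis
      using r by (intro exI [of _ "r/4"]) auto
  qed
  have R: "R a b" if "a \<in> S" "b \<in> S" for a b
  proof (rule connected_equivalence_relation [OF \<open>connected S\<close> that])
    show "R y x" if "R x y" for x y
      using that unfolding R_def by blast
    show "R x z" if xyz: "R x y" "R y z" for x y z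
    proof -
      obtain C where C: "0 \<le> C"
        "\<And>f. f \<in> X \<Longrightarrow> log_size (f x) \<le> C * log_size (f y) \<and> log_size (f y) \<le> C * log_size (f x)"
        using xyz(1) unfolding R_def by auto
      obtain D where D: "0 \<le> D"
        "\<And>f. f \<in> X \<Longrightarrow> log_size (f y) \<le> D * log_size (f z) \<and> log_size (f z) \<le> D * log_size (f y)"
        using xyz(2) unfolding R_def by auto
      have "log_size (f x) \<le> (C * D) * log_size (f z) \<and> log_size (f z) \<le> (C * D) * log_size (f x)"
        if "f \<in> X" for f
      proof
        have "log_size (f x) \<le> C * log_size (f y)" using C D that by blast
        also have "\<dots> \<le> C * (D * log_size (f z))" using C D that by (intro mult_left_mono) auto
        finally show "log_size (f x) \<le> (C * D) * log_size (f z)" by (simp add: mult.assoc)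
        have "log_size (f z) \<le> D * log_size (f y)" using C D that by blast
        also have "\<dots> \<le> D * (C * log_size (f x))" using C D that by (intro mult_left_mono) auto
        finally show "log_size (f z) \<le> (C * D) * log_size (f x)" by (simp add: mult_ac)
      qed
      then show ?thesis
        unfolding R_def using C D by (intro exI [of _ "C * D"]) auto
    qed
    fix a assume "a \<in> S"
    then obtain e where e: "e > 0" "\<forall>x\<in>ball a e. x \<in> S \<and> (\<forall>f\<in>X. log_size (f a) \<le> C * log_size (f x) \<and> log_size (f x) \<le> C * log_size (f a))"
      using loc by blast
    show "\<exists>T. openin (top_of_set S) T \<and> a \<in> T \<and> (\<forall>x\<in>T. R a x)"
    proof (intro exI conjI ballI)
      show "openin (top_of_set S) (ball a e)"
        using e by (intro open_subset) auto
      show "R a x" if "x \<in> ball a e" for x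
        unfolding R_def using e(2) that C(1) by (intro exI [of _ C]) auto
    qed (use e in auto)
  qed
  obtain D where D: "1 \<le> D" "\<And>x. x \<in> K \<Longrightarrow> \<forall>f\<in>X. log_size (f x) \<le> D * log_size (f w)"
  proof (rule compact_uniform_bound [OF \<open>compact K\<close>, where P = "\<lambda>x D. \<forall>f\<in>X. log_size (f x) \<le> D * log_size (f w)"])
    fix a assume "a \<in> K"
    then have "a \<in> S" using assms by blast
    obtain e where e: "e > 0" "\<forall>x\<in>ball a e. x \<in> S \<and> (\<forall>f\<in>X. log_size (f a) \<le> C * log_size (f x) \<and> log_size (f x) \<le> C * log_size (f a))"
      using loc [OF \<open>a \<in> S\<close>] by blast
    obtain D where D: "D \<ge> 0" "\<forall>f\<in>X. log_size (f a) \<le> D * log_size (f w)"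
      using R [OF \<open>a \<in> S\<close> \<open>w \<in> S\<close>] unfolding R_def by blast
    have "log_size (f x) \<le> (C * D) * log_size (f w)" if "x \<in> ball a e" "f \<in> X" for x f
    proof -
      have "log_size (f x) \<le> C * log_size (f a)" using e that by blast
      also have "\<dots> \<le> C * (D * log_size (f w))" using C D that by (intro mult_left_mono) auto
      finally show ?thesis by (simp add: mult.assoc)
    qed
    then show "\<exists>T D. open T \<and> a \<in> T \<and> (\<forall>x\<in>T \<inter> K. \<forall>f\<in>X. log_size (f x) \<le> D * log_size (f w))"
      using e by (intro exI [of _ "ball a e"] exI [of _ "C * D"]) auto
  next
    fix x C D
    assume *: "\<forall>f\<in>X. log_size (f x) \<le> C * log_size (f w)" "C \<le> (D::real)"
    have "C * log_size (f w) \<le> D * log_size (f w)" for f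
      using * by (intro mult_right_mono) auto
    then show "\<forall>f\<in>X. log_size (f x) \<le> D * log_size (f w)"
      using * order_trans by blast
  qed (rule that)
  show thesis
    by (rule that [OF D(1)]) (use D(2) in \<open>auto simp: X_def\<close>)
qed

section \<open>Growth towards the diameter of the half disc\<close>

abbreviation upper_half_disc :: "complex set" where
  "upper_half_disc \<equiv> ball 0 1 \<inter> {z. Im z > 0}"

lemma open_upper_half_disc: "open upper_half_disc"
  by (intro open_Int open_ball open_halfspace_Im_gt)

lemma connected_upper_half_disc: "connected upper_half_disc"
  by (intro convex_connected convex_Int convex_ball convex_halfspace_Im_gt)

lemma ball_subset_upper_half_disc:
  assumes "norm z + s \<le> 1" "s \<le> Im z"
  shows "ball z s \<subseteq> upper_half_disc"
proof
  fix x assume x: "x \<in> ball z s"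
  then have "norm (x - z) < s" by (simp add: dist_norm norm_minus_commute)
  moreover have "\<bar>Im (x - z)\<bar> \<le> norm (x - z)" by (rule abs_Im_le_cmod)
  moreover have "norm x \<le> norm (x - z) + norm z" by (metis diff_add_cancel norm_triangle_ineq)
  ultimately show "x \<in> upper_half_disc"
    using assms by auto
qed

text \<open>Doubling the imaginary part costs a constant factor in the disc estimate, so the logarithm
  of a function omitting 0 and 1 grows at most polynomially towards the diameter.\<close>

lemma log_size_upper_half_disc:
  assumes "0 < \<rho>" "\<rho> < 1"
  obtains C and P :: nat where "1 \<le> C"
    "\<And>f z. \<lbrakk>f holomorphic_on upper_half_disc; \<And>z. z \<in> upper_half_disc \<Longrightarrow> f z \<noteq> 0 \<and> f z \<noteq> 1;
       norm z \<le> \<rho>; 0 < Im z\<rbrakk> \<Longrightarrow> log_size (f z) \<le> C * log_size (f (\<i>/2)) / Im z ^ P"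
proof -
  obtain C where C: "1 \<le> C"
    "\<And>f w R z. \<lbrakk>0 < R; f holomorphic_on ball w R; \<And>z. z \<in> ball w R \<Longrightarrow> f z \<noteq> 0 \<and> f z \<noteq> 1;
       z \<in> cball w (3/4 * R)\<rbrakk> \<Longrightarrow> log_size (f z) \<le> C * log_size (f w)"
    using log_size_omitting_disc by blast
  \<comment> \<open>With C at most 2^P, the loss C in one halving of the height is matched by the
    growth 2^P of 1 / y^P.\<close>
  obtain P :: nat where P: "C \<le> 2 ^ P"
    using real_arch_pow [of 2 C] by (auto intro: less_imp_le)
  \<comment> \<open>For |x| \<le> \<rho> and y < \<eta> the disc about x + 2iy of radius 2y lies in
    the half disc, because |x| + 4y \<le> \<rho> + 4\<eta> = 1.\<close>
  define \<eta> where "\<eta> = (1 - \<rho>) / 4"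
  have \<eta>: "0 < \<eta>" "\<rho> + 4 * \<eta> = 1" using assms by (auto simp: \<eta>_def field_simps)
  define K where "K = cball 0 (\<rho> + 2 * \<eta>) \<inter> {z. \<eta> \<le> Im z}"
  have "compact K"
    unfolding K_def by (intro compact_Int_closed compact_cball closed_halfspace_Im_ge)
  moreover have "K \<subseteq> upper_half_disc"
    using \<eta> by (auto simp: K_def)
  moreover have "\<i>/2 \<in> upper_half_disc" by simp
  ultimately obtain D where D: "1 \<le> D"
    "\<And>f z. \<lbrakk>f holomorphic_on upper_half_disc; \<And>z. z \<in> upper_half_disc \<Longrightarrow> f z \<noteq> 0 \<and> f z \<noteq> 1; z \<in> K\<rbrakk>
      \<Longrightarrow> log_size (f z) \<le> D * log_size (f (\<i>/2))"
    using log_size_omitting_compact [OF open_upper_half_disc connected_upper_half_disc] by metis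
  show thesis
  proof
    show "1 \<le> D" by fact
    fix f :: "complex \<Rightarrow> complex" and z
    assume f: "f holomorphic_on upper_half_disc" "\<And>z. z \<in> upper_half_disc \<Longrightarrow> f z \<noteq> 0 \<and> f z \<noteq> 1"
    let ?M = "D * log_size (f (\<i>/2))"
    have M: "0 \<le> ?M" using D(1) by simp
    have inK: "log_size (f z) \<le> ?M / Im z ^ P" if "z \<in> K" for z
    proof -
      have "Im z \<le> 1" "0 < Im z"
        using that \<eta> abs_Im_le_cmod [of z] by (auto simp: K_def)
      then have "?M * 1 \<le> ?M * (1 / Im z ^ P)"
        by (intro mult_left_mono M) (simp add: power_le_one)
      then show ?thesis
        using D(2) [OF f that] by simp
    qed
    \<comment> \<open>Induction on the number j of doublings that suffice to lift the height y to
      \<eta>, where the point lies in \<open>K\<close>.\<close>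
    have *: "log_size (f (Complex x y)) \<le> ?M / y ^ P"
      if "\<bar>x\<bar> \<le> \<rho>" "0 < y" "y \<le> 2 * \<eta>" "\<eta> \<le> y * 2 ^ j" for x y j
      using that
    proof (induction j arbitrary: y)
      case 0
      have "norm (Complex x y) \<le> \<bar>x\<bar> + \<bar>y\<bar>"
        using cmod_le [of "Complex x y"] by simp
      then have "Complex x y \<in> K"
        using 0 by (auto simp: K_def)
      from inK [OF this] show ?case by simp
    next
      case (Suc j)
      show ?case
      proof (cases "\<eta> \<le> y")
        case True
        have "norm (Complex x y) \<le> \<bar>x\<bar> + \<bar>y\<bar>"
          using cmod_le [of "Complex x y"] by simp
        then have "Complex x y \<in> K"
          using Suc True by (auto simp: K_def)
        from inK [OF this] show ?thesis by simp
      next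
        case False
        have IH: "log_size (f (Complex x (2 * y))) \<le> ?M / (2 * y) ^ P"
          by (rule Suc.IH) (use Suc.prems False in auto)
        have sub: "ball (Complex x (2 * y)) (2 * y) \<subseteq> upper_half_disc"
        proof (rule ball_subset_upper_half_disc)
          have "norm (Complex x (2 * y)) \<le> \<bar>x\<bar> + \<bar>2 * y\<bar>"
            using cmod_le [of "Complex x (2 * y)"] by simp
          then show "norm (Complex x (2 * y)) + 2 * y \<le> 1"
            using Suc.prems False \<eta> by auto
        qed simp
        have "log_size (f (Complex x y)) \<le> C * log_size (f (Complex x (2 * y)))"
        proof (rule C(2) [of "2 * y" f "Complex x (2 * y)" "Complex x y"])
          have "dist (Complex x (2 * y)) (Complex x y) = \<bar>y\<bar>"
            by (simp add: dist_norm cmod_def)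
          then show "Complex x y \<in> cball (Complex x (2 * y)) (3/4 * (2 * y))"
            using Suc.prems by simp
          show "f holomorphic_on ball (Complex x (2 * y)) (2 * y)"
            using f(1) sub by (rule holomorphic_on_subset)
          show "f z \<noteq> 0 \<and> f z \<noteq> 1" if "z \<in> ball (Complex x (2 * y)) (2 * y)" for z
            using f(2) sub that by blast
        qed (use Suc.prems in auto)
        also have "\<dots> \<le> 2 ^ P * (?M / (2 * y) ^ P)"
          using IH P C(1) by (intro mult_mono) auto
        also have "\<dots> = ?M / y ^ P"
          using Suc.prems by (simp add: power_mult_distrib)
        finally show ?thesis .
      qed
    qed
    assume z: "norm z \<le> \<rho>" "0 < Im z"
    show "log_size (f z) \<le> ?M / Im z ^ P"
    proof (cases "\<eta> \<le> Im z")
      case True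
      then show ?thesis using z \<eta> by (intro inK) (auto simp: K_def)
    next
      case False
      obtain j where "\<eta> / Im z < 2 ^ j"
        using real_arch_pow [of 2 "\<eta> / Im z"] by auto
      then have "\<eta> \<le> Im z * 2 ^ j" using z by (simp add: field_simps)
      then have "log_size (f (Complex (Re z) (Im z))) \<le> ?M / Im z ^ P"
        using z False \<eta> abs_Re_le_cmod [of z] by (intro *) auto
      then show ?thesis by simp
    qed
  qed
qed

subsection \<open>Logarithmic derivatives in the slit disc\<close>

abbreviation slit_disc :: "complex set" where
  "slit_disc \<equiv> ball 0 1 - {z. Im z = 0 \<and> 0 \<le> Re z}"

text \<open>One base point in each half disc: the estimates for functions omitting 0 and 1 do not
  pass from one half to the other.\<close>

definition base_size :: "(complex \<Rightarrow> complex) \<Rightarrow> real" where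
  "base_size f = log_size (f (\<i>/2)) + log_size (f (-\<i>/2))"

lemma base_size_ge_2: "2 \<le> base_size f"
  using log_size_ge_1 [of "f (\<i>/2)"] log_size_ge_1 [of "f (-\<i>/2)"] by (simp add: base_size_def)

lemma base_size_pos [simp]: "0 < base_size f" "0 \<le> base_size f"
  using base_size_ge_2 [of f] by linarith+

lemma open_slit_disc: "open slit_disc"
proof -
  have "closed ({z. Im z = 0} \<inter> {z. 0 \<le> Re z})"
    by (intro closed_Int closed_halfspace_Re_ge) (simp add: closed_Collect_eq continuous_intros)
  then have "closed {z. Im z = 0 \<and> 0 \<le> Re z}"
    by (simp add: Collect_conj_eq)
  then show ?thesis by (intro open_Diff open_ball)
qed

text \<open>The reflection exchanges zeros and 1-points. It carries 1 - f, which has no zeros off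
  the other radius, to the same domain \<open>slit_disc\<close>.\<close>

lemma radial_family_reflect:
  assumes "f \<in> radial_family"
  shows "(\<lambda>z. 1 - f (- z)) \<in> radial_family"
proof -
  have hol: "f holomorphic_on ball 0 1"
    and 0: "\<And>z. z \<in> ball 0 1 \<Longrightarrow> f z = 0 \<Longrightarrow> z \<in> \<real> \<and> Re z > 0"
    and 1: "\<And>z. z \<in> ball 0 1 \<Longrightarrow> f z = 1 \<Longrightarrow> z \<in> \<real> \<and> Re z < 0"
    using assms by (auto simp: radial_family_def)
  have "(\<lambda>z. 1 - f (- z)) holomorphic_on ball 0 1"
    by (intro holomorphic_intros holomorphic_on_compose_gen [OF _ hol, unfolded o_def]) auto
  moreover have "z \<in> \<real> \<and> Re z > 0" if "z \<in> ball 0 1" "1 - f (- z) = 0" for z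
    using 1 [of "- z"] that by auto
  moreover have "z \<in> \<real> \<and> Re z < 0" if "z \<in> ball 0 1" "1 - f (- z) = 1" for z
    using 0 [of "- z"] that by auto
  ultimately show ?thesis
    unfolding radial_family_def by blast
qed

lemma radial_family_holomorphic: "f \<in> radial_family \<Longrightarrow> f holomorphic_on ball 0 1"
  by (simp add: radial_family_def)

lemma radial_family_nonzero: "\<lbrakk>f \<in> radial_family; z \<in> slit_disc\<rbrakk> \<Longrightarrow> f z \<noteq> 0"
  by (fastforce simp: radial_family_def complex_is_Real_iff)

lemma radial_family_omits: "\<lbrakk>f \<in> radial_family; z \<in> ball 0 1; Im z \<noteq> 0\<rbrakk> \<Longrightarrow> f z \<noteq> 0 \<and> f z \<noteq> 1"
  by (auto simp: radial_family_def complex_is_Real_iff)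

lemma radial_family_log_size:
  assumes "0 < \<rho>" "\<rho> < 1"
  obtains C and P :: nat where "1 \<le> C"
    "\<And>f z. \<lbrakk>f \<in> radial_family; norm z \<le> \<rho>; Im z \<noteq> 0\<rbrakk>
      \<Longrightarrow> log_size (f z) \<le> C * base_size f / \<bar>Im z\<bar> ^ P"
proof -
  obtain C and P :: nat where C: "1 \<le> C"
    "\<And>f z. \<lbrakk>f holomorphic_on upper_half_disc; \<And>z. z \<in> upper_half_disc \<Longrightarrow> f z \<noteq> 0 \<and> f z \<noteq> 1;
       norm z \<le> \<rho>; 0 < Im z\<rbrakk> \<Longrightarrow> log_size (f z) \<le> C * log_size (f (\<i>/2)) / Im z ^ P"
    using log_size_upper_half_disc [OF assms] by blast
  show thesis
  proof
    show "1 \<le> C" by fact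
    fix f z assume f: "f \<in> radial_family" and z: "norm z \<le> \<rho>" "Im z \<noteq> 0"
    have hol: "f holomorphic_on ball 0 1" using f by (rule radial_family_holomorphic)
    consider "0 < Im z" | "Im z < 0" using z by linarith
    then show "log_size (f z) \<le> C * base_size f / \<bar>Im z\<bar> ^ P"
    proof cases
      case 1
      have "log_size (f z) \<le> C * log_size (f (\<i>/2)) / Im z ^ P"
        by (rule C(2)) (use 1 z radial_family_omits [OF f] in \<open>auto intro: holomorphic_on_subset [OF hol]\<close>)
      also have "\<dots> \<le> C * base_size f / Im z ^ P"
        using C(1) 1 by (intro divide_right_mono mult_left_mono) (auto simp: base_size_def)
      finally show ?thesis using 1 by simp
    next
      case 2
      have "log_size (f (- (- z))) \<le> C * log_size (f (- (\<i>/2))) / Im (- z) ^ P"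
        by (rule C(2) [of "\<lambda>z. f (- z)"])
           (use 2 z radial_family_omits [OF f] in
             \<open>auto intro!: holomorphic_intros holomorphic_on_compose_gen [OF _ hol, unfolded o_def]\<close>)
      also have "\<dots> \<le> C * base_size f / Im (- z) ^ P"
        using C(1) 2 by (intro divide_right_mono mult_left_mono) (auto simp: base_size_def)
      finally show ?thesis using 2 by simp
    qed
  qed
qed

lemma radial_family_log_deriv_nonreal:
  assumes "0 < \<rho>" "\<rho> < 1"
  obtains C and P :: nat where "1 \<le> C" "0 < P"
    "\<And>f z. \<lbrakk>f \<in> radial_family; norm z \<le> \<rho>; Im z \<noteq> 0\<rbrakk>
      \<Longrightarrow> norm (deriv f z / f z) \<le> C * base_size f / \<bar>Im z\<bar> ^ P"
proof -
  obtain C and P :: nat where C: "1 \<le> C"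
    "\<And>f z. \<lbrakk>f \<in> radial_family; norm z \<le> \<rho>; Im z \<noteq> 0\<rbrakk>
      \<Longrightarrow> log_size (f z) \<le> C * base_size f / \<bar>Im z\<bar> ^ P"
    using radial_family_log_size [OF assms] by blast
  obtain D where D: "1 \<le> D"
    "\<And>f w R z. \<lbrakk>0 < R; f holomorphic_on ball w R; \<And>z. z \<in> ball w R \<Longrightarrow> f z \<noteq> 0 \<and> f z \<noteq> 1;
       z \<in> cball w (R/2)\<rbrakk> \<Longrightarrow> norm (deriv f z / f z) \<le> D * log_size (f w) / R"
    using norm_deriv_div_omitting_disc by blast
  show thesis
  proof
    have "1 * 1 \<le> D * C" using C(1) D(1) by (intro mult_mono) auto
    also have "\<dots> \<le> D * C / (1 - \<rho>)"
      using assms C(1) D(1) by (simp add: le_divide_eq mult_left_le)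
    finally show "1 \<le> D * C / (1 - \<rho>)" by simp
    show "0 < Suc P" by simp
    fix f z assume f: "f \<in> radial_family" and z: "norm z \<le> \<rho>" "Im z \<noteq> 0"
    \<comment> \<open>A radius proportional to |Im z|, below the distances to the unit circle and to
      the axis. Dividing by it costs one more power, so that the exponent is positive.\<close>
    define s where "s = (1 - \<rho>) * \<bar>Im z\<bar>"
    have "\<bar>Im z\<bar> \<le> 1" using z assms abs_Im_le_cmod [of z] by linarith
    then have s: "0 < s" "s \<le> 1 - \<rho>" "s \<le> \<bar>Im z\<bar>"
      using assms z by (auto simp: s_def mult_left_le mult_left_le_one_le)
    have sub: "x \<in> ball 0 1 \<and> Im x \<noteq> 0" if "x \<in> ball z s" for x
    proof -
      have *: "norm (x - z) < s" using that by (simp add: dist_norm norm_minus_commute)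
      have "norm x \<le> norm (x - z) + norm z" by (metis diff_add_cancel norm_triangle_ineq)
      moreover have "\<bar>Im x - Im z\<bar> \<le> norm (x - z)" using abs_Im_le_cmod [of "x - z"] by simp
      ultimately show ?thesis using * s z by auto
    qed
    have "norm (deriv f z / f z) \<le> D * log_size (f z) / s"
    proof (rule D(2))
      show "f holomorphic_on ball z s"
        by (rule holomorphic_on_subset [OF radial_family_holomorphic [OF f]]) (use sub in blast)
      show "f x \<noteq> 0 \<and> f x \<noteq> 1" if "x \<in> ball z s" for x
        using radial_family_omits [OF f] sub [OF that] by blast
    qed (use s in auto)
    also have "\<dots> \<le> D * (C * base_size f / \<bar>Im z\<bar> ^ P) / s"
      using s D(1) C(2) [OF f z] by (intro divide_right_mono mult_left_mono) auto
    also have "\<dots> = D * C / (1 - \<rho>) * base_size f / \<bar>Im z\<bar> ^ Suc P"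
      by (simp add: s_def mult_ac)
    finally show "norm (deriv f z / f z) \<le> D * C / (1 - \<rho>) * base_size f / \<bar>Im z\<bar> ^ Suc P" .
  qed
qed

text \<open>Since r^2 = \<zeta> cnj \<zeta>, the difference is \<zeta> (\<zeta> - cnj \<zeta>). This
  factor cancels powers of 1 / |Im x| on a circle with real centre.\<close>

lemma norm_power2_diff_circle:
  fixes \<zeta> :: complex
  assumes "norm \<zeta> = r"
  shows "norm (\<zeta>\<^sup>2 - of_real (r\<^sup>2)) = 2 * r * \<bar>Im \<zeta>\<bar>"
proof -
  have "of_real (r\<^sup>2) = \<zeta> * cnj \<zeta>"
    using complex_norm_square [of \<zeta>] assms by simp
  then have "\<zeta>\<^sup>2 - of_real (r\<^sup>2) = \<zeta> * (\<zeta> - cnj \<zeta>)"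
    by (simp add: power2_eq_square algebra_simps)
  also have "\<zeta> - cnj \<zeta> = of_real (2 * Im \<zeta>) * \<i>"
    by (simp add: complex_eq_iff)
  finally show ?thesis
    using assms by (simp add: norm_mult)
qed

text \<open>The polynomial blow-up at the two real points of a circle is compensated by a
  polynomial factor vanishing there, so that the maximum principle applies.\<close>

lemma radial_family_log_deriv_real:
  assumes "Im c = 0" "0 < r" "cball c r \<subseteq> slit_disc"
  obtains C where "\<And>f z. \<lbrakk>f \<in> radial_family; z \<in> ball c (r/2)\<rbrakk>
      \<Longrightarrow> norm (deriv f z / f z) \<le> C * base_size f"
proof -
  have c: "norm c + r < 1"
  proof -
    obtain x where x: "c = of_real x"
      using assms by (metis complex_is_Real_iff Reals_cases)
    have "c - of_real r \<in> cball c r" "c \<in> cball c r"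
      using assms by (auto simp: dist_norm)
    then have "c - of_real r \<in> slit_disc" "c \<in> slit_disc"
      using assms(3) by blast+
    then have "\<bar>x - r\<bar> < 1" "x < 0"
      by (auto simp: x simp flip: of_real_diff)
    then show ?thesis using assms by (simp add: x)
  qed
  obtain C and P :: nat where C: "1 \<le> C" "0 < P"
    "\<And>f z. \<lbrakk>f \<in> radial_family; norm z \<le> norm c + r; Im z \<noteq> 0\<rbrakk>
      \<Longrightarrow> norm (deriv f z / f z) \<le> C * base_size f / \<bar>Im z\<bar> ^ P"
    using radial_family_log_deriv_nonreal [OF _ c] assms(2) add_nonneg_pos [OF norm_ge_zero] by blast
  show thesis
  proof
    fix f z assume f: "f \<in> radial_family" and z: "z \<in> ball c (r/2)"
    define \<Phi> where "\<Phi> = (\<lambda>x. deriv f x / f x * ((x - c)\<^sup>2 - of_real (r\<^sup>2)) ^ P)"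
    have hol: "f holomorphic_on slit_disc"
      by (rule holomorphic_on_subset [OF radial_family_holomorphic [OF f]]) auto
    have hol\<Phi>: "\<Phi> holomorphic_on slit_disc"
      unfolding \<Phi>_def
      by (intro holomorphic_intros holomorphic_deriv hol open_slit_disc)
         (use radial_family_nonzero [OF f] in auto)
    have "norm (\<Phi> z) \<le> C * base_size f * (2 * r) ^ P"
    proof (rule maximum_modulus_frontier [of \<Phi> "cball c r" _ z])
      show "\<Phi> holomorphic_on interior (cball c r)"
        by (rule holomorphic_on_subset [OF hol\<Phi> subset_trans [OF interior_subset assms(3)]])
      show "continuous_on (closure (cball c r)) \<Phi>"
        unfolding closure_closed [OF closed_cball]
        by (intro holomorphic_on_imp_continuous_on holomorphic_on_subset [OF hol\<Phi>] assms(3))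
      show "z \<in> cball c r" using z assms by auto
      fix x assume "x \<in> frontier (cball c r)"
      then have x: "norm (x - c) = r" by (simp add: dist_norm norm_minus_commute)
      have Im: "norm ((x - c)\<^sup>2 - of_real (r\<^sup>2)) = 2 * r * \<bar>Im x\<bar>"
        using norm_power2_diff_circle [OF x] assms by simp
      show "norm (\<Phi> x) \<le> C * base_size f * (2 * r) ^ P"
      proof (cases "Im x = 0")
        case True
        then have "(x - c)\<^sup>2 - of_real (r\<^sup>2) = 0" using Im by simp
        \<comment> \<open>At a real boundary point the bound from off the axis says nothing, but the
          positive power P makes \<Phi> vanish.\<close>
        then have "\<Phi> x = 0" using C(2) by (simp only: \<Phi>_def zero_power mult_zero_right)
        then show ?thesis using C(1) assms by simp
      next
        case False
        have "norm x \<le> norm c + r" using x norm_triangle_sub [of x c] by simp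
        then have "norm (deriv f x / f x) \<le> C * base_size f / \<bar>Im x\<bar> ^ P"
          using C f False by blast
        then have "norm (\<Phi> x) \<le> C * base_size f / \<bar>Im x\<bar> ^ P * (2 * r * \<bar>Im x\<bar>) ^ P"
          using assms by (simp only: \<Phi>_def norm_mult norm_power Im mult_right_mono zero_le_power
            mult_nonneg_nonneg abs_ge_zero less_imp_le zero_le_numeral)
        also have "\<dots> = C * base_size f * (2 * r) ^ P"
          using False by (simp add: power_mult_distrib)
        finally show ?thesis .
      qed
    qed auto
    \<comment> \<open>For |z - c| < r/2 the base of the compensating power has modulus at least r^2
      - r^2/4, so the power can be divided out.\<close>
    moreover have "(3/4 * r\<^sup>2) ^ P \<le> norm (((z - c)\<^sup>2 - of_real (r\<^sup>2)) ^ P)"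
    proof -
      have "norm ((z - c)\<^sup>2) \<le> (r/2)\<^sup>2"
        unfolding norm_power using z by (intro power_mono) (auto simp: dist_norm norm_minus_commute)
      moreover have "norm (complex_of_real (r\<^sup>2)) = r\<^sup>2" by (simp add: norm_power)
      ultimately have "3/4 * r\<^sup>2 \<le> norm ((z - c)\<^sup>2 - of_real (r\<^sup>2))"
        using norm_triangle_ineq2 [of "of_real (r\<^sup>2)" "(z - c)\<^sup>2"]
        by (simp add: norm_minus_commute power_divide)
      then show ?thesis
        unfolding norm_power using assms by (intro power_mono) auto
    qed
    then have "norm (deriv f z / f z) * (3/4 * r\<^sup>2) ^ P \<le> norm (\<Phi> z)"
      unfolding \<Phi>_def norm_mult [of "deriv f z / f z"] by (intro mult_left_mono) auto
    ultimately have "norm (deriv f z / f z) * (3/4 * r\<^sup>2) ^ P \<le> C * base_size f * (2 * r) ^ P"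
      by linarith
    moreover have "0 < (3/4 * r\<^sup>2) ^ P" using assms by simp
    ultimately have "norm (deriv f z / f z) \<le> C * base_size f * (2 * r) ^ P / (3/4 * r\<^sup>2) ^ P"
      by (simp only: pos_le_divide_eq)
    then show "norm (deriv f z / f z) \<le> C * (2 * r) ^ P / (3/4 * r\<^sup>2) ^ P * base_size f"
      by (simp only: mult.commute mult.left_commute times_divide_eq_left times_divide_eq_right)
  qed
qed

lemma radial_family_log_deriv_compact:
  assumes "compact K" "K \<subseteq> slit_disc"
  obtains C where "1 \<le> C" "\<And>f z. \<lbrakk>f \<in> radial_family; z \<in> K\<rbrakk>
      \<Longrightarrow> norm (deriv f z / f z) \<le> C * base_size f"
proof (rule compact_uniform_bound [OF assms(1), where
      P = "\<lambda>z C. \<forall>f\<in>radial_family. norm (deriv f z / f z) \<le> C * base_size f"])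
  fix a assume "a \<in> K"
  then have a: "a \<in> slit_disc" using assms by blast
  then obtain r where r: "0 < r" "cball a r \<subseteq> slit_disc"
    using open_slit_disc open_contains_cball by blast
  show "\<exists>T C. open T \<and> a \<in> T \<and>
    (\<forall>x\<in>T \<inter> K. \<forall>f\<in>radial_family. norm (deriv f x / f x) \<le> C * base_size f)"
  proof (cases "Im a = 0")
    case True
    obtain C where "\<And>f z. \<lbrakk>f \<in> radial_family; z \<in> ball a (r/2)\<rbrakk>
      \<Longrightarrow> norm (deriv f z / f z) \<le> C * base_size f"
      using radial_family_log_deriv_real [OF True r] by blast
    then show ?thesis
      using r by (intro exI [of _ "ball a (r/2)"] exI [of _ C]) auto
  next
    case False
    define \<rho> where "\<rho> = (1 + norm a) / 2"
    have \<rho>: "0 < \<rho>" "\<rho> < 1" "norm a < \<rho>" 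
      using a by (auto simp: \<rho>_def add_pos_nonneg)
    obtain C and P :: nat where C: "1 \<le> C" "0 < P"
      "\<And>f z. \<lbrakk>f \<in> radial_family; norm z \<le> \<rho>; Im z \<noteq> 0\<rbrakk>
        \<Longrightarrow> norm (deriv f z / f z) \<le> C * base_size f / \<bar>Im z\<bar> ^ P"
      using radial_family_log_deriv_nonreal [OF \<rho>(1,2)] by blast
    define T where "T = ball 0 \<rho> \<inter> {z. \<bar>Im a\<bar> / 2 < \<bar>Im z\<bar>}"
    have "open T"
      unfolding T_def by (intro open_Int open_ball open_Collect_less continuous_intros)
    moreover have "a \<in> T" using \<rho> False by (simp add: T_def)
    moreover have "norm (deriv f x / f x) \<le> C / (\<bar>Im a\<bar> / 2) ^ P * base_size f"
      if "x \<in> T" "f \<in> radial_family" for x f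
    proof -
      have x: "norm x \<le> \<rho>" "\<bar>Im a\<bar> / 2 < \<bar>Im x\<bar>" using that by (auto simp: T_def)
      then have "norm (deriv f x / f x) \<le> C * base_size f / \<bar>Im x\<bar> ^ P"
        using that C False by (intro C(3)) auto
      also have "\<dots> \<le> C * base_size f / (\<bar>Im a\<bar> / 2) ^ P"
        using x C(1) False by (intro divide_left_mono power_mono mult_pos_pos) auto
      finally show ?thesis by (simp add: mult_ac)
    qed
    ultimately show ?thesis by blast
  qed
next
  fix x :: complex and C D :: real
  assume *: "\<forall>f\<in>radial_family. norm (deriv f x / f x) \<le> C * base_size f" "C \<le> D"
  have "C * base_size f \<le> D * base_size f" for f
    using * by (intro mult_right_mono) auto
  then show "\<forall>f\<in>radial_family. norm (deriv f x / f x) \<le> D * base_size f"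
    using * order_trans by blast
qed (use that in blast)

text \<open>Away from -1/2 such a segment meets the axis only if z is itself real, hence negative.
  The slit disc is thus starlike, though not convex, and zero-free functions on it have
  logarithms.\<close>

lemma starlike_slit_disc_segment:
  assumes "z \<in> slit_disc"
  shows "closed_segment (-1/2) z \<subseteq> slit_disc"
proof
  fix y assume y: "y \<in> closed_segment (-1/2) z"
  then obtain t where t: "0 \<le> t" "t \<le> 1" "y = (1 - t) *\<^sub>R (-1/2) + t *\<^sub>R z"
    by (auto simp: in_segment)
  have "closed_segment (-1/2) z \<subseteq> ball 0 1"
    using assms by (intro closed_segment_subset convex_ball) auto
  then have "y \<in> ball 0 1"
    using y by blast
  moreover have "Re y < 0" if "Im y = 0"
  proof (cases "t = 0")
    case False
    then have "Im z = 0" using that t by simp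
    then have "Re z < 0" using assms by auto
    then have "t * Re z < 0" using False t by (simp add: mult_pos_neg)
    then show ?thesis using t by simp
  qed (use t in simp)
  ultimately show "y \<in> slit_disc" by fastforce
qed

lemma contractible_slit_disc: "contractible slit_disc"
proof (rule starlike_imp_contractible)
  have "-1/2 \<in> slit_disc" by simp
  then show "starlike slit_disc"
    unfolding starlike_def using starlike_slit_disc_segment by blast
qed

lemma connected_slit_disc: "connected slit_disc"
  using contractible_slit_disc by (rule contractible_imp_connected)

text \<open>Fixing the branch at i/2 keeps the imaginary parts from escaping along a sequence, so
  that Montel's theorem can be applied to the logarithms.\<close>

lemma radial_family_log_exists:
  assumes "f \<in> radial_family"
  obtains L where "L holomorphic_on slit_disc" "\<And>z. z \<in> slit_disc \<Longrightarrow> f z = exp (L z)"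
    "\<bar>Im (L (\<i>/2))\<bar> \<le> pi"
proof -
  have hol: "f holomorphic_on slit_disc"
    by (rule holomorphic_on_subset [OF radial_family_holomorphic [OF assms]]) auto
  obtain L where L: "L holomorphic_on slit_disc" "\<And>z. z \<in> slit_disc \<Longrightarrow> f z = exp (L z)"
    using contractible_imp_holomorphic_log
      [OF hol contractible_slit_disc radial_family_nonzero [OF assms]] by blast
  define w where "w = Ln (f (\<i>/2)) - L (\<i>/2)"
  have f0: "f (\<i>/2) \<noteq> 0" by (rule radial_family_nonzero [OF assms]) simp
  then have "exp w = 1"
    using L(2) [of "\<i>/2"] by (simp add: w_def exp_diff)
  show thesis
  proof
    show "(\<lambda>z. L z + w) holomorphic_on slit_disc" by (intro holomorphic_intros L)
    show "f z = exp (L z + w)" if "z \<in> slit_disc" for z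
      using L that \<open>exp w = 1\<close> by (simp add: exp_add)
    show "\<bar>Im (L (\<i>/2) + w)\<bar> \<le> pi"
      using mpi_less_Im_Ln [OF f0] Im_Ln_le_pi [OF f0] by (simp add: w_def)
  qed
qed

text \<open>A mean value estimate for L' = f'/f along segments from -1/2. The union
  \<open>K'\<close> of these segments, to the points of \<open>K\<close> and to i/2, is a compact
  part of the slit disc.\<close>

lemma radial_family_log_compact:
  assumes "compact K" "K \<subseteq> slit_disc"
  obtains C where "1 \<le> C" "\<And>f L z. \<lbrakk>f \<in> radial_family; L holomorphic_on slit_disc;
      \<And>z. z \<in> slit_disc \<Longrightarrow> f z = exp (L z); \<bar>Im (L (\<i>/2))\<bar> \<le> pi; z \<in> K\<rbrakk>
      \<Longrightarrow> norm (L z) \<le> C * base_size f"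
proof -
  define K' where "K' = (\<lambda>(t, z). (1 - t) *\<^sub>R (-1/2) + t *\<^sub>R z) ` ({0..1::real} \<times> insert (\<i>/2) K)"
  have "compact K'"
    unfolding K'_def case_prod_beta
    by (intro compact_continuous_image compact_Times continuous_intros compact_insert assms compact_Icc)
  have seg: "closed_segment (-1/2) z \<subseteq> K'" if "z \<in> insert (\<i>/2) K" for z
    using that unfolding K'_def by (fastforce simp: in_segment)
  have half_i: "\<i>/2 \<in> slit_disc" by simp
  have "K' \<subseteq> slit_disc"
  proof
    fix y assume "y \<in> K'"
    then obtain x where x: "x \<in> {0..1} \<times> insert (\<i>/2) K" "y = (\<lambda>(t, z). (1 - t) *\<^sub>R (-1/2) + t *\<^sub>R z) x"
      unfolding K'_def by (rule imageE)
    define t z where "t = fst x" and "z = snd x"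
    have z: "z \<in> insert (\<i>/2) K" and t: "t \<in> {0..1}" "y = (1 - t) *\<^sub>R (-1/2) + t *\<^sub>R z"
      using x by (auto simp: t_def z_def case_prod_beta mem_Times_iff)
    have "y \<in> closed_segment (-1/2) z"
      unfolding in_segment using t by (intro exI [of _ t]) simp
    moreover have "z \<in> slit_disc" using z assms(2) half_i by blast
    ultimately show "y \<in> slit_disc" using starlike_slit_disc_segment by blast
  qed
  then obtain C where C: "1 \<le> C" "\<And>f z. \<lbrakk>f \<in> radial_family; z \<in> K'\<rbrakk>
      \<Longrightarrow> norm (deriv f z / f z) \<le> C * base_size f"
    using radial_family_log_deriv_compact [OF \<open>compact K'\<close>] by blast
  show thesis
  proof
    \<comment> \<open>Going from i/2 to z by way of -1/2 takes two segments of length at most 2,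
      which costs 4 C; the summands 1 and pi account for the real and imaginary parts of L at
      i/2.\<close>
    show "1 \<le> 4 * C + 1 + pi" using C pi_gt_zero by linarith
    fix f L z
    assume f: "f \<in> radial_family" and L: "L holomorphic_on slit_disc"
      "\<And>z. z \<in> slit_disc \<Longrightarrow> f z = exp (L z)" "\<bar>Im (L (\<i>/2))\<bar> \<le> pi" and z: "z \<in> K"
    have dL: "(L has_field_derivative deriv f x / f x) (at x)" if "x \<in> slit_disc" for x
    proof -
      have L': "(L has_field_derivative deriv L x) (at x)"
        using holomorphic_derivI [OF L(1) open_slit_disc that] .
      then have "((\<lambda>x. exp (L x)) has_field_derivative f x * deriv L x) (at x)"
        using L(2) [OF that] by (auto intro!: derivative_eq_intros)
      then have "(f has_field_derivative f x * deriv L x) (at x)"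
        by (rule has_field_derivative_transform_within_open [OF _ open_slit_disc that])
           (use L in auto)
      then have "deriv f x = f x * deriv L x" by (rule DERIV_imp_deriv)
      then show ?thesis using L' L(2) [OF that] by simp
    qed
    have dist: "norm (L x - L (-1/2)) \<le> 2 * C * base_size f" if x: "x \<in> insert (\<i>/2) K" for x
    proof -
      have "norm (L x - L (-1/2)) \<le> C * base_size f * norm (x - (-1/2))"
      proof (rule field_differentiable_bound [OF convex_closed_segment])
        fix y assume y: "y \<in> closed_segment (-1/2) x"
        then have "y \<in> slit_disc" using seg [OF x] \<open>K' \<subseteq> slit_disc\<close> by blast
        then show "(L has_field_derivative deriv f y / f y) (at y within closed_segment (-1/2) x)"
          using dL has_field_derivative_at_within by blast
        show "norm (deriv f y / f y) \<le> C * base_size f"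
          using C(2) f y seg [OF x] by blast
      qed auto
      also have "\<dots> \<le> C * base_size f * 2"
      proof (intro mult_left_mono)
        have "x \<in> slit_disc" using x assms(2) half_i by blast
        then have "norm x < 1" by simp
        then show "norm (x - (-1/2)) \<le> 2" using norm_triangle_ineq4 [of x "-1/2"] by simp
      qed (use C in simp)
      finally show ?thesis by (simp add: mult_ac)
    qed
    have "norm (L z - L (\<i>/2)) \<le> 4 * C * base_size f"
      using dist [of z] dist [of "\<i>/2"] z norm_triangle_ineq4 [of "L z - L (-1/2)" "L (\<i>/2) - L (-1/2)"]
      by simp
    moreover have "norm (L (\<i>/2)) \<le> base_size f + pi"
    proof -
      have "ln (norm (f (\<i>/2))) = Re (L (\<i>/2))" using L(2) [of "\<i>/2"] by simp
      then have "\<bar>Re (L (\<i>/2))\<bar> \<le> base_size f"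
        using log_size_ge_1 [of "f (-\<i>/2)"] unfolding base_size_def log_size_def [of "f (\<i>/2)"] by linarith
      then show ?thesis using cmod_le [of "L (\<i>/2)"] L(3) by linarith
    qed
    moreover have "pi \<le> pi * base_size f"
      using base_size_ge_2 [of f] by simp
    ultimately have "norm (L z) \<le> 4 * C * base_size f + base_size f + pi * base_size f"
      using norm_triangle_sub [of "L z" "L (\<i>/2)"] by linarith
    then show "norm (L z) \<le> (4 * C + 1 + pi) * base_size f" by (simp add: algebra_simps)
  qed
qed

text \<open>Montel's theorem for the logarithms divided by \<open>A k\<close>. The factor is left
  free so that a sequence and its reflection can share one.\<close>

lemma radial_family_ln_norm_limit:
  assumes f: "range f \<subseteq> radial_family" and A: "\<And>k. base_size (f k) \<le> A k"
  obtains l and r :: "nat \<Rightarrow> nat" where "l holomorphic_on slit_disc" "strict_mono r"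
    "\<And>K. \<lbrakk>compact K; K \<subseteq> slit_disc\<rbrakk> \<Longrightarrow>
      uniform_limit K (\<lambda>k z. ln (norm (f (r k) z)) / A (r k)) (\<lambda>z. Re (l z)) sequentially"
proof -
  have "\<forall>k. \<exists>L. L holomorphic_on slit_disc \<and> (\<forall>z\<in>slit_disc. f k z = exp (L z)) \<and> \<bar>Im (L (\<i>/2))\<bar> \<le> pi"
  proof
    fix k
    have "f k \<in> radial_family" using f by blast
    then show "\<exists>L. L holomorphic_on slit_disc \<and> (\<forall>z\<in>slit_disc. f k z = exp (L z)) \<and> \<bar>Im (L (\<i>/2))\<bar> \<le> pi"
      by (rule radial_family_log_exists) (intro exI conjI ballI)
  qed
  from choice [OF this] obtain L where L: "\<And>k. L k holomorphic_on slit_disc"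
    "\<And>k z. z \<in> slit_disc \<Longrightarrow> f k z = exp (L k z)" "\<And>k. \<bar>Im (L k (\<i>/2))\<bar> \<le> pi"
    by blast
  have A0: "0 < A k" for k using A [of k] base_size_pos [of "f k"] by linarith
  define h where "h = (\<lambda>k z. L k z / of_real (A k))"
  have holh: "h k holomorphic_on slit_disc" for k
    unfolding h_def using A0 [of k] by (intro holomorphic_intros L) auto
  have bdd: "\<exists>B. \<forall>h \<in> range h. \<forall>z\<in>K. norm (h z) \<le> B" if K: "compact K" "K \<subseteq> slit_disc" for K
  proof -
    obtain C where C: "1 \<le> C" "\<And>f L z. \<lbrakk>f \<in> radial_family; L holomorphic_on slit_disc;
      \<And>z. z \<in> slit_disc \<Longrightarrow> f z = exp (L z); \<bar>Im (L (\<i>/2))\<bar> \<le> pi; z \<in> K\<rbrakk>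
      \<Longrightarrow> norm (L z) \<le> C * base_size f"
      using radial_family_log_compact [OF K] by blast
    have "norm (h k z) \<le> C" if "z \<in> K" for k z
    proof -
      have "norm (L k z) \<le> C * base_size (f k)"
        by (rule C(2) [OF _ L(1) L(2) L(3) that]) (use f in auto)
      also have "\<dots> \<le> C * A k" using A C(1) by (intro mult_left_mono) auto
      finally show ?thesis using A0 [of k] by (simp add: h_def norm_divide divide_le_eq)
    qed
    then show ?thesis by blast
  qed
  obtain l r where lr: "l holomorphic_on slit_disc" "strict_mono (r :: nat \<Rightarrow> nat)"
    "\<And>K. \<lbrakk>compact K; K \<subseteq> slit_disc\<rbrakk> \<Longrightarrow> uniform_limit K (h \<circ> r) l sequentially"
    by (rule Montel [OF open_slit_disc, of "range h" h]) (use holh bdd in \<open>auto simp only:\<close>)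
  show thesis
  proof
    fix K assume K: "compact K" "K \<subseteq> slit_disc"
    have eq: "ln (norm (f (r k) z)) / A (r k) = Re (h (r k) z)" if "z \<in> K" for k z
    proof -
      have "z \<in> slit_disc" using that K by blast
      then have "f (r k) z = exp (L (r k) z)" by (rule L(2))
      then show ?thesis by (simp add: h_def)
    qed
    have "uniform_limit K (\<lambda>k z. Re ((h \<circ> r) k z)) (\<lambda>z. Re (l z)) sequentially"
      by (intro bounded_linear.uniform_limit [OF bounded_linear_Re] lr(3) K)
    then show "uniform_limit K (\<lambda>k z. ln (norm (f (r k) z)) / A (r k)) (\<lambda>z. Re (l z)) sequentially"
      by (rule uniform_limit_cong' [THEN iffD1, rotated -1]) (use eq in auto)
  qed (use lr in auto)
qed

section \<open>Bounded and divergent sequences, and maximum principles for real parts\<close>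

definition locally_bounded_seq :: "complex set \<Rightarrow> (nat \<Rightarrow> complex \<Rightarrow> complex) \<Rightarrow> bool" where
  "locally_bounded_seq S f \<longleftrightarrow> (\<forall>K. compact K \<and> K \<subseteq> S \<longrightarrow>
     (\<exists>B. \<forall>\<^sub>F k in sequentially. \<forall>z\<in>K. norm (f k z) \<le> B))"

definition locally_divergent_seq :: "complex set \<Rightarrow> (nat \<Rightarrow> complex \<Rightarrow> complex) \<Rightarrow> bool" where
  "locally_divergent_seq S f \<longleftrightarrow> (\<forall>K B. compact K \<and> K \<subseteq> S \<longrightarrow>
     (\<forall>\<^sub>F k in sequentially. \<forall>z\<in>K. B \<le> norm (f k z)))"

lemma eventually_subseq:
  assumes "strict_mono r" "\<forall>\<^sub>F k in sequentially. P (k::nat)"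
  shows "\<forall>\<^sub>F k in sequentially. P (r k)"
  using filterlim_subseq [OF assms(1)] assms(2) by (simp add: filterlim_iff)

lemma locally_bounded_seq_subseq:
  assumes "locally_bounded_seq S f" "strict_mono r"
  shows "locally_bounded_seq S (f \<circ> r)"
  unfolding locally_bounded_seq_def
proof (intro allI impI)
  fix K assume "compact K \<and> K \<subseteq> S"
  then obtain B where "\<forall>\<^sub>F k in sequentially. \<forall>z\<in>K. norm (f k z) \<le> B"
    using assms(1) unfolding locally_bounded_seq_def by blast
  then show "\<exists>B. \<forall>\<^sub>F k in sequentially. \<forall>z\<in>K. norm ((f \<circ> r) k z) \<le> B"
    using eventually_subseq [OF assms(2)] by (intro exI [of _ B]) simp
qed

lemma base_size_bounded_imp_locally_bounded:
  assumes f: "range f \<subseteq> radial_family" and M: "\<And>k. base_size (f k) \<le> M"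
  shows "locally_bounded_seq slit_disc f"
  unfolding locally_bounded_seq_def
proof (intro allI impI, elim conjE)
  fix K :: "complex set" assume K: "compact K" "K \<subseteq> slit_disc"
  obtain C where C: "1 \<le> C" "\<And>f L z. \<lbrakk>f \<in> radial_family; L holomorphic_on slit_disc;
    \<And>z. z \<in> slit_disc \<Longrightarrow> f z = exp (L z); \<bar>Im (L (\<i>/2))\<bar> \<le> pi; z \<in> K\<rbrakk>
    \<Longrightarrow> norm (L z) \<le> C * base_size f"
    using radial_family_log_compact [OF K] by blast
  have "norm (f k z) \<le> exp (C * M)" if "z \<in> K" for k z
  proof -
    have fk: "f k \<in> radial_family" using f by auto
    obtain L where L: "L holomorphic_on slit_disc" "\<And>z. z \<in> slit_disc \<Longrightarrow> f k z = exp (L z)"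
      "\<bar>Im (L (\<i>/2))\<bar> \<le> pi"
      using radial_family_log_exists [OF fk] by blast
    have "Re (L z) \<le> norm (L z)" by (rule complex_Re_le_cmod)
    also have "\<dots> \<le> C * base_size (f k)"
      by (rule C(2) [OF fk L that])
    also have "\<dots> \<le> C * M" using M C(1) by (intro mult_left_mono) auto
    finally have "Re (L z) \<le> C * M" .
    moreover have "z \<in> slit_disc" using that K by blast
    ultimately show ?thesis by (simp only: L(2) norm_exp_eq_Re exp_le_cancel_iff)
  qed
  then show "\<exists>B. \<forall>\<^sub>F k in sequentially. \<forall>z\<in>K. norm (f k z) \<le> B"
    by (intro exI always_eventually allI ballI)
qed

text \<open>Maximum modulus principle for exp (l z). It also acts as an identity theorem: if Re l is
  constant on a nonempty open subset, it is constant on \<open>S\<close>.\<close>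

lemma Re_constant_of_local_max:
  assumes "l holomorphic_on S" "open S" "connected S" "open U" "U \<subseteq> S" "\<xi> \<in> U"
    and "\<And>z. z \<in> U \<Longrightarrow> Re (l z) \<le> Re (l \<xi>)" "z \<in> S"
  shows "Re (l z) = Re (l \<xi>)"
proof -
  have "(\<lambda>z. exp (l z)) constant_on S"
    by (rule maximum_modulus_principle [OF _ assms(2-6)]) (use assms in \<open>auto intro: holomorphic_intros\<close>)
  then have "exp (l z) = exp (l \<xi>)"
    using assms by (auto simp: constant_on_def)
  then show ?thesis by (metis exp_inj_iff norm_exp_eq_Re)
qed

text \<open>A zero of Re l would be a maximum, and Re l would vanish identically.\<close>

lemma Re_nonpos_cases:
  assumes "l holomorphic_on S" "open S" "connected S" "\<And>z. z \<in> S \<Longrightarrow> Re (l z) \<le> 0"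
    "z0 \<in> S" "Re (l z0) \<noteq> 0" "z \<in> S"
  shows "Re (l z) < 0"
proof (rule ccontr)
  assume "\<not> Re (l z) < 0"
  then have "Re (l z) = 0" using assms(4) [OF \<open>z \<in> S\<close>] by linarith
  then have "Re (l z0) = Re (l z)"
    using assms by (intro Re_constant_of_local_max [OF assms(1-3) assms(2) order_refl]) auto
  with \<open>Re (l z) = 0\<close> assms show False by simp
qed

text \<open>Points of the negative radius are approached vertically, through points where f omits
  both values.\<close>

lemma nonpos_slit_disc_of_nonreal:
  assumes cont: "continuous_on slit_disc u" and u: "\<And>z. \<lbrakk>z \<in> ball 0 1; Im z \<noteq> 0\<rbrakk> \<Longrightarrow> u z \<le> (0::real)"
    and z: "z \<in> slit_disc"
  shows "u z \<le> 0"
proof (cases "Im z = 0")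
  case True
  define x where "x = (\<lambda>n. z + of_real (1 / Suc n) * \<i>)"
  have "x \<longlonglongrightarrow> z + of_real 0 * \<i>"
    unfolding x_def by (intro tendsto_intros LIMSEQ_inverse_real_of_nat [unfolded inverse_eq_divide])
  then have x: "x \<longlonglongrightarrow> z" by simp
  have "isCont u z"
    using cont open_slit_disc z continuous_on_eq_continuous_at by blast
  then have "(\<lambda>n. u (x n)) \<longlonglongrightarrow> u z"
    using x isCont_tendsto_compose by blast
  moreover have "\<forall>\<^sub>F n in sequentially. x n \<in> slit_disc"
    using x open_slit_disc z topological_tendstoD by blast
  then have "\<forall>\<^sub>F n in sequentially. u (x n) \<le> 0"
    by eventually_elim (use True in \<open>auto intro!: u simp: x_def\<close>)
  ultimately show ?thesis
    by (rule tendsto_upperbound) simp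
qed (use u z in auto)

lemma scaled_uniform_limit_pos:
  fixes h :: "nat \<Rightarrow> 'a::topological_space \<Rightarrow> real"
  assumes "compact K" "continuous_on K u" "\<And>z. z \<in> K \<Longrightarrow> 0 < u z"
    and lim: "uniform_limit K (\<lambda>k z. h k z / A k) u sequentially"
    and A: "filterlim A at_top sequentially"
  shows "\<forall>\<^sub>F k in sequentially. \<forall>z\<in>K. B \<le> h k z"
proof (cases "K = {}")
  case False
  then obtain m where m: "m \<in> K" "\<And>z. z \<in> K \<Longrightarrow> u m \<le> u z"
    using continuous_attains_inf [OF assms(1) _ assms(2)] by blast
  have "0 < u m" using assms m by blast
  then have "\<forall>\<^sub>F k in sequentially. \<forall>z\<in>K. dist (h k z / A k) (u z) < u m / 2"
    using uniform_limitD [OF lim, of "u m / 2"] by simp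
  \<comment> \<open>The 1 makes \<open>A k\<close> positive; the other term lifts u m / 2 times
    \<open>A k\<close> above B.\<close>
  moreover have "\<forall>\<^sub>F k in sequentially. max 1 (2 * B / u m) \<le> A k"
    using A unfolding filterlim_at_top by blast
  ultimately show ?thesis
  proof eventually_elim
    case (elim k)
    show ?case
    proof
      fix z assume z: "z \<in> K"
      have "dist (h k z / A k) (u z) < u m / 2"
        using elim(1) z by blast
      then have "u m / 2 \<le> h k z / A k"
        using m(2) [OF z] unfolding dist_real_def by linarith
      then have "u m / 2 * A k \<le> h k z"
        using elim(2) by (simp add: le_divide_eq)
      moreover have "B \<le> u m / 2 * A k"
        using elim(2) \<open>0 < u m\<close> by (simp add: field_simps)
      ultimately show "B \<le> h k z" by simp
    qed
  qed
qed simp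

subsection \<open>Limits of normalized logarithms\<close>

lemma tendsto_zero_of_scaled_ln:
  fixes a :: "nat \<Rightarrow> complex"
  assumes "\<And>k. a k \<noteq> 0" and A: "filterlim A at_top sequentially"
    and s: "(\<lambda>k. ln (norm (a k)) / A k) \<longlonglongrightarrow> s" "s < 0"
  shows "a \<longlonglongrightarrow> 0"
proof -
  have "filterlim (\<lambda>k. ln (norm (a k)) / A k * A k) at_bot sequentially"
    by (rule filterlim_tendsto_neg_mult_at_bot [OF s A])
  moreover have "\<forall>\<^sub>F k in sequentially. 0 < A k"
    using A by (simp add: filterlim_at_top_dense)
  then have "\<forall>\<^sub>F k in sequentially. ln (norm (a k)) / A k * A k = ln (norm (a k))"
    by eventually_elim simp
  note filterlim_cong [OF refl refl this]
  ultimately have "filterlim (\<lambda>k. ln (norm (a k))) at_bot sequentially"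
    by simp
  then have "(\<lambda>k. exp (ln (norm (a k)))) \<longlonglongrightarrow> 0"
    by (rule filterlim_compose [OF exp_at_bot])
  then show ?thesis
    using assms(1) by (simp add: tendsto_norm_zero_iff)
qed

text \<open>Here \<open>a\<close> tends to 0, so ln |1 - a| stays bounded and disappears in the
  division by \<open>A\<close>.\<close>

lemma scaled_ln_one_minus_neg:
  fixes a :: "nat \<Rightarrow> complex"
  assumes "\<And>k. a k \<noteq> 0" and A: "filterlim A at_top sequentially"
    and s: "(\<lambda>k. ln (norm (a k)) / A k) \<longlonglongrightarrow> s" "s < 0"
    and t: "(\<lambda>k. ln (norm (1 - a k)) / A k) \<longlonglongrightarrow> t"
  shows "t = 0"
proof -
  have "a \<longlonglongrightarrow> 0" by (rule tendsto_zero_of_scaled_ln [OF assms(1-4)])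
  then have "(\<lambda>k. ln (norm (1 - a k))) \<longlonglongrightarrow> ln (norm (1 - 0 :: complex))"
    by (intro tendsto_intros) auto
  then have "(\<lambda>k. ln (norm (1 - a k)) / A k) \<longlonglongrightarrow> 0"
    using A by (intro real_tendsto_divide_at_top)
  with t show ?thesis by (rule LIMSEQ_unique)
qed

text \<open>Here 1/a tends to 0, and 1 - a = - a (1 - 1/a) shows that ln |a| and ln |1 - a| differ
  by a bounded amount.\<close>

lemma scaled_ln_one_minus_pos:
  fixes a :: "nat \<Rightarrow> complex"
  assumes a: "\<And>k. a k \<noteq> 0" "\<And>k. a k \<noteq> 1" and A: "filterlim A at_top sequentially"
    and s: "(\<lambda>k. ln (norm (a k)) / A k) \<longlonglongrightarrow> s" "0 < s"
    and t: "(\<lambda>k. ln (norm (1 - a k)) / A k) \<longlonglongrightarrow> t"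
  shows "t = s"
proof -
  have "(\<lambda>k. ln (norm (inverse (a k))) / A k) \<longlonglongrightarrow> - s"
  proof -
    have "ln (norm (inverse (a k))) / A k = - (ln (norm (a k)) / A k)" for k
      using a(1) [of k] by (simp add: norm_inverse ln_inverse)
    then show ?thesis by (simp only: tendsto_minus [OF s(1)])
  qed
  moreover have "inverse (a k) \<noteq> 0" for k using a by simp
  ultimately have "(\<lambda>k. inverse (a k)) \<longlonglongrightarrow> 0"
    using s(2) by (intro tendsto_zero_of_scaled_ln [OF _ A]) auto
  then have "(\<lambda>k. ln (norm (1 - inverse (a k)))) \<longlonglongrightarrow> ln (norm (1 - 0 :: complex))"
    by (intro tendsto_intros) auto
  then have "(\<lambda>k. ln (norm (1 - inverse (a k))) / A k) \<longlonglongrightarrow> 0"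
    using A by (intro real_tendsto_divide_at_top)
  then have "(\<lambda>k. ln (norm (a k)) / A k + ln (norm (1 - inverse (a k))) / A k) \<longlonglongrightarrow> s + 0"
    by (intro tendsto_add s)
  moreover have "ln (norm (a k)) / A k + ln (norm (1 - inverse (a k))) / A k = ln (norm (1 - a k)) / A k" for k
  proof -
    have "1 - a k = - a k * (1 - inverse (a k))"
      using a(1) [of k] by (simp add: field_simps)
    then have "norm (1 - a k) = norm (a k) * norm (1 - inverse (a k))"
      by (simp only: norm_mult norm_minus_cancel)
    moreover have "1 - inverse (a k) \<noteq> 0" using a [of k] by auto
    ultimately have "ln (norm (1 - a k)) = ln (norm (a k)) + ln (norm (1 - inverse (a k)))"
      using a(1) [of k] by (simp add: ln_mult)
    then show ?thesis by (simp add: add_divide_distrib)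
  qed
  ultimately have "(\<lambda>k. ln (norm (1 - a k)) / A k) \<longlonglongrightarrow> s" by simp
  with t show ?thesis by (rule LIMSEQ_unique)
qed

lemma uniform_limit_subseq:
  assumes "uniform_limit K h u sequentially" "strict_mono (r :: nat \<Rightarrow> nat)"
  shows "uniform_limit K (\<lambda>k. h (r k)) u sequentially"
  using filterlim_compose [OF assms(1) filterlim_subseq [OF assms(2)]] .

text \<open>In terms of the limits u and v, u = Re l and v(z) = Re (m (- z)). The hypotheses are
  symmetric in f and g, so that each fact about l holds for m by \<open>reflected\<close>.\<close>

locale reflected_log_limits =
  fixes f g :: "nat \<Rightarrow> complex \<Rightarrow> complex" and l m :: "complex \<Rightarrow> complex"
  assumes f_in: "f k \<in> radial_family" and g_in: "g k \<in> radial_family"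
    and f_plus_g: "f k z + g k (- z) = 1"
    and f_top: "filterlim (\<lambda>k. base_size (f k)) at_top sequentially"
    and g_top: "filterlim (\<lambda>k. base_size (g k)) at_top sequentially"
    and l: "l holomorphic_on slit_disc" and m: "m holomorphic_on slit_disc"
    and f_lim: "\<And>K. \<lbrakk>compact K; K \<subseteq> slit_disc\<rbrakk> \<Longrightarrow> uniform_limit K
      (\<lambda>k z. ln (norm (f k z)) / (base_size (f k) + base_size (g k))) (\<lambda>z. Re (l z)) sequentially"
    and g_lim: "\<And>K. \<lbrakk>compact K; K \<subseteq> slit_disc\<rbrakk> \<Longrightarrow> uniform_limit K
      (\<lambda>k z. ln (norm (g k z)) / (base_size (f k) + base_size (g k))) (\<lambda>z. Re (m z)) sequentially"
begin

lemma reflected: "reflected_log_limits g f m l"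
proof unfold_locales
  show "g k z + f k (- z) = 1" for k z
    using f_plus_g [of k "- z"] by (simp add: add.commute)
qed (use g_lim f_lim in \<open>simp_all only: f_in g_in f_top g_top l m add.commute [of "base_size (g _)"]\<close>)

abbreviation "A \<equiv> \<lambda>k. base_size (f k) + base_size (g k)"

lemma A_top: "filterlim A at_top sequentially"
  by (rule filterlim_at_top_add_at_top [OF f_top g_top])

lemma f_tendsto: "z \<in> slit_disc \<Longrightarrow> (\<lambda>k. ln (norm (f k z)) / A k) \<longlonglongrightarrow> Re (l z)"
  by (rule tendsto_uniform_limitI [OF f_lim [of "{z}"]]) auto

lemma g_tendsto: "z \<in> slit_disc \<Longrightarrow> (\<lambda>k. ln (norm (g k z)) / A k) \<longlonglongrightarrow> Re (m z)"
  by (rule tendsto_uniform_limitI [OF g_lim [of "{z}"]]) auto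

lemma one_minus: "1 - f k z = g k (- z)"
  using f_plus_g [of k z] by (simp add: algebra_simps)

lemma Re_limits:
  assumes z: "z \<in> ball 0 1" "Im z \<noteq> 0"
  shows "Re (l z) < 0 \<Longrightarrow> Re (m (- z)) = 0" "0 < Re (l z) \<Longrightarrow> Re (m (- z)) = Re (l z)"
proof -
  have slit: "z \<in> slit_disc" "- z \<in> slit_disc" using z by auto
  have f01: "f k z \<noteq> 0" "f k z \<noteq> 1" for k
    using radial_family_omits [OF f_in z] by auto
  have t: "(\<lambda>k. ln (norm (1 - f k z)) / A k) \<longlonglongrightarrow> Re (m (- z))"
    using g_tendsto [OF slit(2)] by (simp add: one_minus)
  show "Re (m (- z)) = 0" if "Re (l z) < 0"
    by (rule scaled_ln_one_minus_neg [OF f01(1) A_top f_tendsto [OF slit(1)] that t])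
  show "Re (m (- z)) = Re (l z)" if "0 < Re (l z)"
    by (rule scaled_ln_one_minus_pos [OF f01 A_top f_tendsto [OF slit(1)] that t])
qed

lemma half_i_in: "\<i>/2 \<in> slit_disc" "-\<i>/2 \<in> slit_disc"
  by auto

text \<open>\<open>A k\<close> is exactly 4 plus the four absolute logarithms at the base points,
  and 4 / A k tends to 0.\<close>

lemma normalization:
  "\<bar>Re (l (\<i>/2))\<bar> + \<bar>Re (l (-\<i>/2))\<bar> + \<bar>Re (m (\<i>/2))\<bar> + \<bar>Re (m (-\<i>/2))\<bar> = 1"
proof -
  have "(\<lambda>k. 4 / A k + \<bar>ln (norm (f k (\<i>/2))) / A k\<bar> + \<bar>ln (norm (f k (-\<i>/2))) / A k\<bar>
      + \<bar>ln (norm (g k (\<i>/2))) / A k\<bar> + \<bar>ln (norm (g k (-\<i>/2))) / A k\<bar>)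
    \<longlonglongrightarrow> 0 + \<bar>Re (l (\<i>/2))\<bar> + \<bar>Re (l (-\<i>/2))\<bar> + \<bar>Re (m (\<i>/2))\<bar> + \<bar>Re (m (-\<i>/2))\<bar>"
    by (intro tendsto_add tendsto_rabs f_tendsto g_tendsto half_i_in
        real_tendsto_divide_at_top [OF tendsto_const A_top])
  moreover have "4 / A k + \<bar>ln (norm (f k (\<i>/2))) / A k\<bar> + \<bar>ln (norm (f k (-\<i>/2))) / A k\<bar>
      + \<bar>ln (norm (g k (\<i>/2))) / A k\<bar> + \<bar>ln (norm (g k (-\<i>/2))) / A k\<bar> = 1" for k
  proof -
    have pos: "0 < A k" by (simp add: add_pos_pos)
    have "A k = 4 + \<bar>ln (norm (f k (\<i>/2)))\<bar> + \<bar>ln (norm (f k (-\<i>/2)))\<bar>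
      + \<bar>ln (norm (g k (\<i>/2)))\<bar> + \<bar>ln (norm (g k (-\<i>/2)))\<bar>"
      by (simp add: base_size_def log_size_def)
    then have "(4 + \<bar>ln (norm (f k (\<i>/2)))\<bar> + \<bar>ln (norm (f k (-\<i>/2)))\<bar>
      + \<bar>ln (norm (g k (\<i>/2)))\<bar> + \<bar>ln (norm (g k (-\<i>/2)))\<bar>) / A k = 1"
      using pos by simp
    then show ?thesis
      using pos by (simp only: abs_divide abs_of_pos add_divide_distrib)
  qed
  ultimately have "(\<lambda>k. 1) \<longlonglongrightarrow> 0 + \<bar>Re (l (\<i>/2))\<bar> + \<bar>Re (l (-\<i>/2))\<bar> + \<bar>Re (m (\<i>/2))\<bar> + \<bar>Re (m (-\<i>/2))\<bar>"
    by (simp only:)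
  from LIMSEQ_unique [OF this tendsto_const] show ?thesis by simp
qed

lemma continuous_Re_l: "continuous_on slit_disc (\<lambda>z. Re (l z))"
  by (intro continuous_intros holomorphic_on_imp_continuous_on l)

text \<open>If \<open>ln |1 - f k|\<close> were negligible, \<open>f k\<close> would tend to 0 at both base points, so that
  the reflected functions would have bounded base size.\<close>

lemma limit_m_nontrivial: "\<exists>z\<in>slit_disc. Re (m z) \<noteq> 0"
proof (rule ccontr)
  assume "\<not> ?thesis"
  then have m0: "Re (m z) = 0" if "z \<in> slit_disc" for z using that by blast
  have nonreal: "Re (l z) \<le> 0" if z: "z \<in> ball 0 1" "Im z \<noteq> 0" for z
  proof (rule ccontr)
    assume "\<not> Re (l z) \<le> 0"
    moreover have "- z \<in> slit_disc" using z by auto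
    ultimately show False using Re_limits(2) [OF z] m0 by fastforce
  qed
  have le: "Re (l z) \<le> 0" if "z \<in> slit_disc" for z
    by (rule nonpos_slit_disc_of_nonreal [OF continuous_Re_l nonreal that])
  \<comment> \<open>With m trivial, the normalization leaves a base point at which Re l is not
    0.\<close>
  obtain z0 where "z0 \<in> slit_disc" "Re (l z0) \<noteq> 0"
    using normalization m0 half_i_in by fastforce
  then have neg: "Re (l z) < 0" if "z \<in> slit_disc" for z
    using Re_nonpos_cases [OF l open_slit_disc connected_slit_disc le] that by blast
  have zero: "(\<lambda>k. f k z) \<longlonglongrightarrow> 0" if "z \<in> slit_disc" for z
    using tendsto_zero_of_scaled_ln [OF _ A_top f_tendsto [OF that] neg [OF that]]
      radial_family_nonzero [OF f_in that] by blast
  have "(\<lambda>k. log_size (g k (- z))) \<longlonglongrightarrow> 1 + \<bar>ln (norm (1 - 0 :: complex))\<bar>" if "z \<in> slit_disc" for z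
    unfolding log_size_def one_minus [symmetric]
    by (intro tendsto_intros zero that) auto
  from tendsto_add [OF this [OF half_i_in(2)] this [OF half_i_in(1)]]
  have "(\<lambda>k. base_size (g k)) \<longlonglongrightarrow> 2"
    by (simp add: base_size_def)
  then show False
    using g_top not_tendsto_and_filterlim_at_infinity [OF _ _ filterlim_at_top_imp_at_infinity]
    by (metis sequentially_bot)
qed

lemma limit_l_nontrivial: "\<exists>z\<in>slit_disc. Re (l z) \<noteq> 0"
  by (rule reflected_log_limits.limit_m_nontrivial [OF reflected])

text \<open>By \<open>Re_limits\<close>, one of u and v vanishes wherever they differ. It would
  vanish on an open set and then identically, since the slit disc is connected across the negative
  radius; but neither limit is trivial.\<close>

lemma limits_agree:
  assumes z: "z \<in> ball 0 1" "Im z \<noteq> 0"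
  shows "Re (l z) = Re (m (- z))"
proof (rule ccontr)
  assume ne: "Re (l z) \<noteq> Re (m (- z))"
  define D where "D = ball 0 1 \<inter> {z. Im z \<noteq> 0}"
  have D: "open D" "D \<subseteq> slit_disc" "uminus ` D \<subseteq> slit_disc"
    unfolding D_def by (auto intro!: open_Int open_Collect_neq continuous_intros)
  have contm: "continuous_on D (\<lambda>z. Re (m (- z)))"
    by (intro continuous_on_Re continuous_on_compose2 [OF holomorphic_on_imp_continuous_on [OF m]])
       (use D(3) in \<open>auto intro!: continuous_intros simp only:\<close>)
  have contl: "continuous_on D (\<lambda>z. Re (l z))"
    using continuous_Re_l D(2) continuous_on_subset by blast
  define U where "U = {z \<in> D. Re (l z) \<noteq> Re (m (- z))}"
  have "open U"
  proof -
    have "open (D \<inter> (\<lambda>z. Re (l z) - Re (m (- z))) -` (- {0}))"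
      by (intro continuous_open_preimage continuous_on_diff contl contm D) auto
    moreover have "D \<inter> (\<lambda>z. Re (l z) - Re (m (- z))) -` (- {0}) = U"
      by (auto simp: U_def)
    ultimately show ?thesis by simp
  qed
  have "z \<in> U" using z ne by (simp add: U_def D_def)
  have prod: "Re (l x) = 0 \<or> Re (m (- x)) = 0" if "x \<in> U" for x
    using Re_limits [of x] that by (fastforce simp: U_def D_def)
  show False
  proof (cases "\<exists>x\<in>U. Re (l x) \<noteq> 0")
    case True
    then obtain x where x: "x \<in> U" "Re (l x) \<noteq> 0" by blast
    \<comment> \<open>If u is nonzero at some point of \<open>U\<close>, it is so on the open set
      \<open>V\<close>, and there v must vanish.\<close>
    define V where "V = {y \<in> U. Re (l y) \<noteq> 0}"
    have "continuous_on U (\<lambda>z. Re (l z))"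
      by (rule continuous_on_subset [OF contl]) (auto simp: U_def)
    then have "open (U \<inter> (\<lambda>z. Re (l z)) -` (- {0}))"
      by (intro continuous_open_preimage \<open>open U\<close>) auto
    moreover have "U \<inter> (\<lambda>z. Re (l z)) -` (- {0}) = V" by (auto simp: V_def)
    ultimately have "open V" by simp
    then have "open (uminus ` V)" by (rule open_negations)
    have m0: "Re (m y) = 0" if "y \<in> uminus ` V" for y
      using that prod by (auto simp: V_def)
    have sub: "uminus ` V \<subseteq> slit_disc" using D(3) by (auto simp: V_def U_def)
    have "- x \<in> uminus ` V" using x by (simp add: V_def)
    have "Re (m y) = Re (m (- x))" if "y \<in> slit_disc" for y
      by (rule Re_constant_of_local_max [OF m open_slit_disc connected_slit_disc
            \<open>open (uminus ` V)\<close> sub \<open>- x \<in> uminus ` V\<close> _ that]) (use m0 \<open>- x \<in> uminus ` V\<close> in auto)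
    then show False
      using limit_m_nontrivial m0 \<open>- x \<in> uminus ` V\<close> by auto
  next
    case False
    have sub: "U \<subseteq> slit_disc" using D(2) by (auto simp: U_def)
    have "Re (l y) = Re (l z)" if "y \<in> slit_disc" for y
      by (rule Re_constant_of_local_max [OF l open_slit_disc connected_slit_disc
            \<open>open U\<close> sub \<open>z \<in> U\<close> _ that]) (use False \<open>z \<in> U\<close> in auto)
    then show False
      using limit_l_nontrivial False \<open>z \<in> U\<close> by auto
  qed
qed

text \<open>A negative value of u forces v = 0, against u = v. So u is nonnegative, and the maximum
  principle for - u makes it positive.\<close>

lemma limit_l_pos:
  assumes "z \<in> slit_disc"
  shows "0 < Re (l z)"
proof -
  have nonreal: "- Re (l z) \<le> 0" if z: "z \<in> ball 0 1" "Im z \<noteq> 0" for z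
    using Re_limits(1) [OF z] limits_agree [OF z] by linarith
  have le: "Re (- l z) \<le> 0" if "z \<in> slit_disc" for z
    using nonpos_slit_disc_of_nonreal [OF continuous_on_minus [OF continuous_Re_l] nonreal that] by simp
  obtain z0 where z0: "z0 \<in> slit_disc" "Re (l z0) \<noteq> 0"
    using limit_l_nontrivial by blast
  have "Re (- l z) < 0"
    by (rule Re_nonpos_cases [of "\<lambda>z. - l z", OF holomorphic_on_minus [OF l] open_slit_disc
          connected_slit_disc le z0(1) _ assms]) (use z0(2) in simp_all)
  then show ?thesis by simp
qed

lemma f_locally_divergent: "locally_divergent_seq slit_disc f"
  unfolding locally_divergent_seq_def
proof (intro allI impI, elim conjE)
  fix K B assume K: "compact K" "K \<subseteq> slit_disc"
  \<comment> \<open>\<open>max 1 B\<close> keeps the argument of the logarithm positive for every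
    B.\<close>
  have "\<forall>\<^sub>F k in sequentially. \<forall>z\<in>K. ln (max 1 B) \<le> ln (norm (f k z))"
    by (rule scaled_uniform_limit_pos [OF K(1) continuous_on_subset [OF continuous_Re_l K(2)] _ f_lim [OF K] A_top])
       (use limit_l_pos K in blast)
  then show "\<forall>\<^sub>F k in sequentially. \<forall>z\<in>K. B \<le> norm (f k z)"
  proof eventually_elim
    case (elim k)
    show ?case
    proof
      fix z assume z: "z \<in> K"
      then have "z \<in> slit_disc" using K by blast
      then have "0 < norm (f k z)" using radial_family_nonzero [OF f_in] by simp
      moreover have "ln (max 1 B) \<le> ln (norm (f k z))" using elim z by blast
      ultimately have "max 1 B \<le> norm (f k z)"
        by (subst (asm) ln_le_cancel_iff) (simp_all add: less_max_iff_disj)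
      then show "B \<le> norm (f k z)" by simp
    qed
  qed
qed

end

section \<open>The dichotomy for subsequences\<close>

lemma reflected_limit_case:
  assumes f: "range f \<subseteq> radial_family" and g: "range g \<subseteq> radial_family"
    and fg: "\<And>k z. f k z + g k (- z) = 1"
    and f_top: "filterlim (\<lambda>k. base_size (f k)) at_top sequentially"
    and g_top: "filterlim (\<lambda>k. base_size (g k)) at_top sequentially"
  obtains r :: "nat \<Rightarrow> nat" where "strict_mono r"
    "locally_divergent_seq slit_disc (f \<circ> r)" "locally_divergent_seq slit_disc (g \<circ> r)"
proof -
  let ?A = "\<lambda>k. base_size (f k) + base_size (g k)"
  have A: "base_size (f k) \<le> ?A k" for k by simp
  obtain l and r :: "nat \<Rightarrow> nat" where l: "l holomorphic_on slit_disc" "strict_mono r"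
    "\<And>K. \<lbrakk>compact K; K \<subseteq> slit_disc\<rbrakk> \<Longrightarrow>
      uniform_limit K (\<lambda>k z. ln (norm (f (r k) z)) / ?A (r k)) (\<lambda>z. Re (l z)) sequentially"
    by (rule radial_family_ln_norm_limit [OF f A]) (rule that)
  have gr: "range (g \<circ> r) \<subseteq> radial_family" using g by auto
  \<comment> \<open>The second extraction takes place along \<open>r\<close> and with the same
    factor, so that both limits belong to one subsequence and one normalization.\<close>
  have Ar: "base_size ((g \<circ> r) k) \<le> (?A \<circ> r) k" for k by simp
  obtain m and s :: "nat \<Rightarrow> nat" where m: "m holomorphic_on slit_disc" "strict_mono s"
    "\<And>K. \<lbrakk>compact K; K \<subseteq> slit_disc\<rbrakk> \<Longrightarrow>
      uniform_limit K (\<lambda>k z. ln (norm ((g \<circ> r) (s k) z)) / (?A \<circ> r) (s k)) (\<lambda>z. Re (m z)) sequentially"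
    by (rule radial_family_ln_norm_limit [OF gr Ar]) (rule that)
  have rs: "strict_mono (r \<circ> s)" using l(2) m(2) by (rule strict_mono_o)
  have "reflected_log_limits (f \<circ> (r \<circ> s)) (g \<circ> (r \<circ> s)) l m"
  proof
    show "(f \<circ> (r \<circ> s)) k \<in> radial_family" "(g \<circ> (r \<circ> s)) k \<in> radial_family" for k
      using f g by auto
    show "(f \<circ> (r \<circ> s)) k z + (g \<circ> (r \<circ> s)) k (- z) = 1" for k z
      using fg by simp
    show "filterlim (\<lambda>k. base_size ((f \<circ> (r \<circ> s)) k)) at_top sequentially"
      using filterlim_compose [OF f_top filterlim_subseq [OF rs]] by simp
    show "filterlim (\<lambda>k. base_size ((g \<circ> (r \<circ> s)) k)) at_top sequentially"
      using filterlim_compose [OF g_top filterlim_subseq [OF rs]] by simp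
    fix K assume K: "compact K" "K \<subseteq> slit_disc"
    show "uniform_limit K (\<lambda>k z. ln (norm ((f \<circ> (r \<circ> s)) k z)) /
        (base_size ((f \<circ> (r \<circ> s)) k) + base_size ((g \<circ> (r \<circ> s)) k))) (\<lambda>z. Re (l z)) sequentially"
      using uniform_limit_subseq [OF l(3) [OF K] m(2)] by simp
    show "uniform_limit K (\<lambda>k z. ln (norm ((g \<circ> (r \<circ> s)) k z)) /
        (base_size ((f \<circ> (r \<circ> s)) k) + base_size ((g \<circ> (r \<circ> s)) k))) (\<lambda>z. Re (m z)) sequentially"
      using m(3) [OF K] by simp
  qed (fact l(1) m(1))+
  then interpret reflected_log_limits "f \<circ> (r \<circ> s)" "g \<circ> (r \<circ> s)" l m .
  show thesis
    using rs f_locally_divergent reflected_log_limits.f_locally_divergent [OF reflected] by (rule that)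
qed

text \<open>Off the axis f = 1 - g(-z) is bounded, so the limit of ln |f| /
  \<open>base_size f\<close> is at most 0 there, and on the slit disc by continuity. It is nonzero
  at a base point, hence negative everywhere, and |f| is eventually at most 1 on compact
  sets.\<close>

lemma bounded_reflection_case:
  assumes f: "range f \<subseteq> radial_family" and g: "range g \<subseteq> radial_family"
    and fg: "\<And>k z. f k z + g k (- z) = 1"
    and f_top: "filterlim (\<lambda>k. base_size (f k)) at_top sequentially"
    and g_bdd: "\<And>k. base_size (g k) \<le> M"
  obtains r :: "nat \<Rightarrow> nat" where "strict_mono r" "locally_bounded_seq slit_disc (f \<circ> r)"
proof -
  obtain l and r :: "nat \<Rightarrow> nat" where l: "l holomorphic_on slit_disc" "strict_mono r"
    "\<And>K. \<lbrakk>compact K; K \<subseteq> slit_disc\<rbrakk> \<Longrightarrow>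
      uniform_limit K (\<lambda>k z. ln (norm (f (r k) z)) / base_size (f (r k))) (\<lambda>z. Re (l z)) sequentially"
    by (rule radial_family_ln_norm_limit [OF f order_refl]) (rule that)
  have f_in: "f k \<in> radial_family" for k using f by auto
  have A: "filterlim (\<lambda>k. base_size (f (r k))) at_top sequentially"
    using filterlim_compose [OF f_top filterlim_subseq [OF l(2)]] .
  have lim: "(\<lambda>k. ln (norm (f (r k) z)) / base_size (f (r k))) \<longlonglongrightarrow> Re (l z)" if "z \<in> slit_disc" for z
    by (rule tendsto_uniform_limitI [OF l(3) [of "{z}"]]) (use that in auto)
  have nonreal: "Re (l z) \<le> 0" if z: "z \<in> ball 0 1" "Im z \<noteq> 0" for z
  proof -
    have "- z \<in> slit_disc" and zs: "z \<in> slit_disc" using z by auto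
    then have "compact {- z} \<and> {- z} \<subseteq> slit_disc"
      by (intro conjI insert_subsetI compact_sing empty_subsetI)
    with base_size_bounded_imp_locally_bounded [OF g g_bdd]
    obtain B where "\<forall>\<^sub>F k in sequentially. \<forall>z\<in>{- z}. norm (g k z) \<le> B"
      unfolding locally_bounded_seq_def by blast
    from eventually_subseq [OF l(2) this]
    have "\<forall>\<^sub>F k in sequentially. norm (g (r k) (- z)) \<le> B"
      by simp
    then have "\<forall>\<^sub>F k in sequentially. ln (norm (f (r k) z)) / base_size (f (r k)) \<le> ln (1 + B) / base_size (f (r k))"
    proof eventually_elim
      case (elim k)
      have "f (r k) z = 1 - g (r k) (- z)" using fg [of "r k" z] by (simp add: algebra_simps)
      then have "norm (f (r k) z) \<le> 1 + B"
        using norm_triangle_ineq4 [of 1 "g (r k) (- z)"] elim by simp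
      moreover have "0 < norm (f (r k) z)"
        using radial_family_nonzero [OF f_in zs] by simp
      ultimately have "ln (norm (f (r k) z)) \<le> ln (1 + B)"
        using ln_le_cancel_iff [of "norm (f (r k) z)" "1 + B"] by linarith
      then show ?case by (intro divide_right_mono) auto
    qed
    moreover have "(\<lambda>k. ln (1 + B) / base_size (f (r k))) \<longlonglongrightarrow> 0"
      by (rule real_tendsto_divide_at_top [OF tendsto_const A])
    ultimately show ?thesis
      using lim [OF zs] by (intro tendsto_le [OF sequentially_bot]) auto
  qed
  have cont: "continuous_on slit_disc (\<lambda>z. Re (l z))"
    by (intro continuous_intros holomorphic_on_imp_continuous_on l)
  have le: "Re (l z) \<le> 0" if "z \<in> slit_disc" for z
    by (rule nonpos_slit_disc_of_nonreal [OF cont nonreal that])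
  have half: "\<i>/2 \<in> slit_disc" "-\<i>/2 \<in> slit_disc" by auto
  have "(\<lambda>k. 2 / base_size (f (r k)) + \<bar>ln (norm (f (r k) (\<i>/2))) / base_size (f (r k))\<bar>
      + \<bar>ln (norm (f (r k) (-\<i>/2))) / base_size (f (r k))\<bar>)
    \<longlonglongrightarrow> 0 + \<bar>Re (l (\<i>/2))\<bar> + \<bar>Re (l (-\<i>/2))\<bar>"
    by (intro tendsto_add tendsto_rabs lim half real_tendsto_divide_at_top [OF tendsto_const A])
  moreover have "2 / base_size (f k) + \<bar>ln (norm (f k (\<i>/2))) / base_size (f k)\<bar>
      + \<bar>ln (norm (f k (-\<i>/2))) / base_size (f k)\<bar> = 1" for k
  proof -
    have "base_size (f k) = 2 + \<bar>ln (norm (f k (\<i>/2)))\<bar> + \<bar>ln (norm (f k (-\<i>/2)))\<bar>"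
      by (simp add: base_size_def log_size_def)
    then have "(2 + \<bar>ln (norm (f k (\<i>/2)))\<bar> + \<bar>ln (norm (f k (-\<i>/2)))\<bar>) / base_size (f k) = 1"
      using base_size_pos [of "f k"] by simp
    then show ?thesis
      by (simp only: abs_divide abs_of_pos base_size_pos add_divide_distrib)
  qed
  ultimately have "(\<lambda>k. 1) \<longlonglongrightarrow> 0 + \<bar>Re (l (\<i>/2))\<bar> + \<bar>Re (l (-\<i>/2))\<bar>"
    by (simp only:)
  from LIMSEQ_unique [OF this tendsto_const]
  have "\<bar>Re (l (\<i>/2))\<bar> + \<bar>Re (l (-\<i>/2))\<bar> = 1" by simp
  then obtain z0 where z0: "z0 \<in> slit_disc" "Re (l z0) \<noteq> 0"
    using half by force
  have neg: "Re (l z) < 0" if "z \<in> slit_disc" for z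
    by (rule Re_nonpos_cases [OF l(1) open_slit_disc connected_slit_disc le z0 that])
  have "locally_bounded_seq slit_disc (f \<circ> r)"
    unfolding locally_bounded_seq_def
  proof (intro allI impI, elim conjE)
    fix K :: "complex set" assume K: "compact K" "K \<subseteq> slit_disc"
    have "uniform_limit K (\<lambda>k z. - ln (norm (f (r k) z)) / base_size (f (r k))) (\<lambda>z. - Re (l z)) sequentially"
      using uniform_limit_uminus [OF l(3) [OF K]] by (simp only: minus_divide_left)
    then have "\<forall>\<^sub>F k in sequentially. \<forall>z\<in>K. 0 \<le> - ln (norm (f (r k) z))"
      using neg K(2) by (intro scaled_uniform_limit_pos [OF K(1) continuous_on_minus
        [OF continuous_on_subset [OF cont K(2)]] _ _ A]) (auto simp only: neg_0_less_iff_less)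
    then have "\<forall>\<^sub>F k in sequentially. \<forall>z\<in>K. norm ((f \<circ> r) k z) \<le> 1"
    proof eventually_elim
      case (elim k)
      show ?case
      proof
        fix z assume z: "z \<in> K"
        then have "z \<in> slit_disc" using K by blast
        then have "0 < norm (f (r k) z)" using radial_family_nonzero [OF f_in] by simp
        moreover have "ln (norm (f (r k) z)) \<le> 0" using elim z by fastforce
        ultimately show "norm ((f \<circ> r) k z) \<le> 1" by simp
      qed
    qed
    then show "\<exists>B. \<forall>\<^sub>F k in sequentially. \<forall>z\<in>K. norm ((f \<circ> r) k z) \<le> B" ..
  qed
  with l(2) show thesis by (rule that)
qed

text \<open>The left half of \<open>K\<close> and the reflected right half both lie in the slit
  disc, so estimates for f and for its reflection together cover everything but the origin.\<close>

lemma compact_punctured_disc_split: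
  assumes "compact K" "K \<subseteq> ball 0 1 - {0::complex}"
  obtains K1 K2 where "compact K1" "K1 \<subseteq> slit_disc" "compact K2" "K2 \<subseteq> slit_disc"
    "\<And>z. z \<in> K \<Longrightarrow> z \<in> K1 \<or> - z \<in> K2"
proof
  show "compact (K \<inter> {z. Re z \<le> 0})" "compact (uminus ` (K \<inter> {z. Re z \<ge> 0}))"
    by (intro compact_Int_closed compact_negations assms closed_halfspace_Re_le closed_halfspace_Re_ge)+
  show "K \<inter> {z. Re z \<le> 0} \<subseteq> slit_disc"
  proof
    fix z assume z: "z \<in> K \<inter> {z. Re z \<le> 0}"
    then have "z \<in> ball 0 1" "z \<noteq> 0" using assms by auto
    then show "z \<in> slit_disc" using z by (auto simp: complex_eq_iff)
  qed
  show "uminus ` (K \<inter> {z. Re z \<ge> 0}) \<subseteq> slit_disc"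
  proof
    fix z assume "z \<in> uminus ` (K \<inter> {z. Re z \<ge> 0})"
    then have z: "- z \<in> K" "Re z \<le> 0" by auto
    then have "- z \<in> ball 0 1" "- z \<noteq> 0" using assms by blast+
    then show "z \<in> slit_disc" using z by (auto simp: complex_eq_iff)
  qed
qed auto

lemma locally_bounded_seq_glue:
  assumes fg: "\<And>k z. f k z + g k (- z) = 1"
    and "locally_bounded_seq slit_disc f" "locally_bounded_seq slit_disc g"
  shows "locally_bounded_seq (ball 0 1 - {0}) f"
  unfolding locally_bounded_seq_def
proof (intro allI impI, elim conjE)
  fix K :: "complex set" assume "compact K" "K \<subseteq> ball 0 1 - {0}"
  then obtain K1 K2 where K: "compact K1" "K1 \<subseteq> slit_disc" "compact K2" "K2 \<subseteq> slit_disc"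
    "\<And>z. z \<in> K \<Longrightarrow> z \<in> K1 \<or> - z \<in> K2"
    using compact_punctured_disc_split by blast
  obtain B where "\<forall>\<^sub>F k in sequentially. \<forall>z\<in>K1. norm (f k z) \<le> B"
    using assms(2) K unfolding locally_bounded_seq_def by blast
  moreover obtain C where "\<forall>\<^sub>F k in sequentially. \<forall>z\<in>K2. norm (g k z) \<le> C"
    using assms(3) K unfolding locally_bounded_seq_def by blast
  ultimately have "\<forall>\<^sub>F k in sequentially. \<forall>z\<in>K. norm (f k z) \<le> max B (1 + C)"
  proof eventually_elim
    case (elim k)
    show ?case
    proof
      fix z assume z: "z \<in> K"
      have "f k z = 1 - g k (- z)" using fg [of k z] by (simp add: algebra_simps)
      then have "norm (f k z) \<le> 1 + norm (g k (- z))"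
        using norm_triangle_ineq4 [of 1 "g k (- z)"] by simp
      then show "norm (f k z) \<le> max B (1 + C)" using K(5) [OF z] elim by fastforce
    qed
  qed
  then show "\<exists>B. \<forall>\<^sub>F k in sequentially. \<forall>z\<in>K. norm (f k z) \<le> B" ..
qed

lemma locally_divergent_seq_glue:
  assumes fg: "\<And>k z. f k z + g k (- z) = 1"
    and "locally_divergent_seq slit_disc f" "locally_divergent_seq slit_disc g"
  shows "locally_divergent_seq (ball 0 1 - {0}) f"
  unfolding locally_divergent_seq_def
proof (intro allI impI, elim conjE)
  fix K :: "complex set" and B assume "compact K" "K \<subseteq> ball 0 1 - {0}"
  then obtain K1 K2 where K: "compact K1" "K1 \<subseteq> slit_disc" "compact K2" "K2 \<subseteq> slit_disc"
    "\<And>z. z \<in> K \<Longrightarrow> z \<in> K1 \<or> - z \<in> K2"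
    using compact_punctured_disc_split by blast
  have "\<forall>\<^sub>F k in sequentially. \<forall>z\<in>K1. B \<le> norm (f k z)"
    using assms(2) K unfolding locally_divergent_seq_def by blast
  moreover have "\<forall>\<^sub>F k in sequentially. \<forall>z\<in>K2. B + 1 \<le> norm (g k z)"
    using assms(3) K unfolding locally_divergent_seq_def by blast
  ultimately show "\<forall>\<^sub>F k in sequentially. \<forall>z\<in>K. B \<le> norm (f k z)"
  proof eventually_elim
    case (elim k)
    show ?case
    proof
      fix z assume z: "z \<in> K"
      have "g k (- z) = 1 - f k z" using fg [of k z] by (simp add: algebra_simps)
      then have "norm (g k (- z)) \<le> 1 + norm (f k z)"
        using norm_triangle_ineq4 [of 1 "f k z"] by simp
      then show "B \<le> norm (f k z)" using K(5) [OF z] elim by fastforce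
    qed
  qed
qed

lemma bounded_subseq_of_not_at_top:
  fixes a :: "nat \<Rightarrow> real"
  assumes "\<not> filterlim a at_top sequentially"
  obtains r :: "nat \<Rightarrow> nat" and M where "strict_mono r" "\<And>k. a (r k) \<le> M"
proof -
  obtain M where "\<not> (\<forall>\<^sub>F k in sequentially. M < a k)"
    using assms by (auto simp: filterlim_at_top_dense)
  then obtain r :: "nat \<Rightarrow> nat" where "strict_mono r" "\<And>k. \<not> M < a (r k)"
    using not_eventually_sequentiallyD by blast
  then show thesis by (intro that [of r M]) (simp_all add: not_less)
qed

text \<open>Divergence arises if both base sizes tend to infinity. Otherwise one of them is bounded
  along a subsequence, and the other tends to infinity, as in
  \<open>bounded_reflection_case\<close>, or is bounded along a further subsequence.\<close>

lemma radial_family_dichotomy: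
  assumes f: "range f \<subseteq> radial_family"
  obtains r :: "nat \<Rightarrow> nat" where "strict_mono r"
    "locally_bounded_seq (ball 0 1 - {0}) (f \<circ> r) \<or> locally_divergent_seq (ball 0 1 - {0}) (f \<circ> r)"
proof -
  define g where "g = (\<lambda>k z. 1 - f k (- z))"
  have g: "range g \<subseteq> radial_family"
    using f radial_family_reflect by (auto simp: g_def)
  have fg: "f k z + g k (- z) = 1" and gf: "g k z + f k (- z) = 1" for k z
    by (auto simp: g_def)
  have sub: "range (f \<circ> r) \<subseteq> radial_family" "range (g \<circ> r) \<subseteq> radial_family" for r :: "nat \<Rightarrow> nat"
    using f g by auto
  show thesis
  proof (cases "filterlim (\<lambda>k. base_size (f k)) at_top sequentially")
    case f_top: True
    show thesis
    proof (cases "filterlim (\<lambda>k. base_size (g k)) at_top sequentially")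
      case True
      obtain r :: "nat \<Rightarrow> nat" where r: "strict_mono r"
        "locally_divergent_seq slit_disc (f \<circ> r)" "locally_divergent_seq slit_disc (g \<circ> r)"
        using reflected_limit_case [OF f g fg f_top True] by blast
      have "locally_divergent_seq (ball 0 1 - {0}) (f \<circ> r)"
        by (rule locally_divergent_seq_glue [OF _ r(2,3)]) (simp add: fg)
      with r(1) show thesis by (intro that) auto
    next
      case False
      then obtain r :: "nat \<Rightarrow> nat" and M where r: "strict_mono r" "\<And>k. base_size (g (r k)) \<le> M"
        by (rule bounded_subseq_of_not_at_top) blast
      have "filterlim (\<lambda>k. base_size ((f \<circ> r) k)) at_top sequentially"
        using filterlim_compose [OF f_top filterlim_subseq [OF r(1)]] by simp
      then obtain s :: "nat \<Rightarrow> nat" where s: "strict_mono s" "locally_bounded_seq slit_disc ((f \<circ> r) \<circ> s)"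
        by (rule bounded_reflection_case [OF sub, of r r, rotated]) (use fg r(2) in auto)
      have "locally_bounded_seq slit_disc (g \<circ> r)"
        by (rule base_size_bounded_imp_locally_bounded [OF sub(2), of r M]) (use r in simp)
      then have "locally_bounded_seq slit_disc ((g \<circ> r) \<circ> s)"
        using s(1) by (rule locally_bounded_seq_subseq)
      with s(2) have "locally_bounded_seq (ball 0 1 - {0}) ((f \<circ> r) \<circ> s)"
        by (rule locally_bounded_seq_glue [rotated]) (simp add: fg)
      then show thesis
        using strict_mono_o [OF r(1) s(1)] by (intro that) (auto simp: comp_assoc)
    qed
  next
    case False
    then obtain r :: "nat \<Rightarrow> nat" and M where r: "strict_mono r" "\<And>k. base_size (f (r k)) \<le> M"
      by (rule bounded_subseq_of_not_at_top) blast
    have f_bdd: "locally_bounded_seq slit_disc (f \<circ> r)"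
      by (rule base_size_bounded_imp_locally_bounded [OF sub(1), of r M]) (use r in simp)
    have "\<exists>s. strict_mono (s :: nat \<Rightarrow> nat) \<and> locally_bounded_seq slit_disc ((g \<circ> r) \<circ> s)"
    proof (cases "filterlim (\<lambda>k. base_size ((g \<circ> r) k)) at_top sequentially")
      case True
      then obtain s :: "nat \<Rightarrow> nat" where s: "strict_mono s" "locally_bounded_seq slit_disc ((g \<circ> r) \<circ> s)"
        by (rule bounded_reflection_case [OF sub(2,1), of r r, rotated]) (use gf r(2) in auto)
      then show ?thesis by blast
    next
      case False
      then obtain s :: "nat \<Rightarrow> nat" and N where s: "strict_mono s" "\<And>k. base_size ((g \<circ> r) (s k)) \<le> N"
        by (rule bounded_subseq_of_not_at_top) blast
      have "locally_bounded_seq slit_disc ((g \<circ> r) \<circ> s)"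
        by (rule base_size_bounded_imp_locally_bounded [of _ N]) (use s g in auto)
      with s(1) show ?thesis by blast
    qed
    then obtain s :: "nat \<Rightarrow> nat" where s: "strict_mono s" "locally_bounded_seq slit_disc ((g \<circ> r) \<circ> s)"
      by blast
    have "locally_bounded_seq (ball 0 1 - {0}) ((f \<circ> r) \<circ> s)"
      by (rule locally_bounded_seq_glue [OF _ locally_bounded_seq_subseq [OF f_bdd s(1)] s(2)]) (simp add: fg)
    then show thesis
      using strict_mono_o [OF r(1) s(1)] by (intro that) (auto simp: comp_assoc)
  qed
qed

subsection \<open>Simple zeros near the origin\<close>

text \<open>The local factorization at \<open>a\<close> is continued by f z / (z - a)^n. The point
  \<open>b\<close> rules out that f vanishes identically; n is 0 if f a \<noteq> 0.\<close>

lemma holomorphic_factor_point: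
  assumes f: "f holomorphic_on S" and S: "open S" "connected S" and "a \<in> S" "b \<in> S" "f b \<noteq> 0"
  obtains g n where "g holomorphic_on S" "\<And>z. z \<in> S \<Longrightarrow> f z = (z - a) ^ n * g z" "g a \<noteq> 0"
proof (cases "f a = 0")
  case True
  have nonconst: "\<not> f constant_on S"
  proof
    assume "f constant_on S"
    then have "f b = f a" using assms(4,5) by (auto simp: constant_on_def)
    then show False using True assms(6) by simp
  qed
  obtain g r n where g: "0 < n" "0 < r" "ball a r \<subseteq> S" "g holomorphic_on ball a r"
      "\<And>w. w \<in> ball a r \<Longrightarrow> f w = (w - a) ^ n * g w" "\<And>w. w \<in> ball a r \<Longrightarrow> g w \<noteq> 0"
    by (rule holomorphic_factor_zero_nonconstant [OF f S \<open>a \<in> S\<close> True nonconst]) (rule that)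
  define h where "h = (\<lambda>z. if z \<in> ball a r then g z else f z / (z - a) ^ n)"
  have "h holomorphic_on ball a r \<union> (S - {a})"
    unfolding h_def
  proof (rule holomorphic_on_If_Un)
    show "(\<lambda>z. f z / (z - a) ^ n) holomorphic_on S - {a}"
      by (intro holomorphic_intros holomorphic_on_subset [OF f]) auto
    show "g z = f z / (z - a) ^ n" if "z \<in> ball a r" "z \<in> S - {a}" for z
      using g(5) [OF that(1)] that(2) by simp
  qed (use g S in \<open>auto intro: open_delete\<close>)
  moreover have "ball a r \<union> (S - {a}) = S" using g(2,3) by auto
  ultimately have "h holomorphic_on S" by simp
  moreover have "f z = (z - a) ^ n * h z" if "z \<in> S" for z
    using g(2,5) by (cases "z \<in> ball a r") (auto simp: h_def)
  moreover have "h a \<noteq> 0" using g(2,6) by (simp add: h_def)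
  ultimately show thesis by (rule that)
next
  case False
  show thesis by (rule that [of f 0]) (use f False in auto)
qed

text \<open>A list records multiplicities. Zeros are removed one point at a time, while
  \<open>b\<close> keeps witnessing that the quotient is not identically 0.\<close>

lemma holomorphic_factor_finite:
  assumes f: "f holomorphic_on S" and S: "open S" "connected S" and b: "b \<in> S" "f b \<noteq> 0"
    and Z: "finite Z" "Z \<subseteq> S"
  obtains xs g where "g holomorphic_on S" "set xs \<subseteq> Z"
    "\<And>z. z \<in> S \<Longrightarrow> f z = (\<Prod>x\<leftarrow>xs. z - x) * g z" "\<And>z. z \<in> Z \<Longrightarrow> g z \<noteq> 0"
proof -
  have "\<exists>xs g. g holomorphic_on S \<and> set xs \<subseteq> Z \<and>
      (\<forall>z\<in>S. f z = (\<Prod>x\<leftarrow>xs. z - x) * g z) \<and> (\<forall>z\<in>Z. g z \<noteq> 0)"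
    using Z
  proof (induction Z rule: finite_induct)
    case empty
    show ?case by (rule exI [of _ "[]"], rule exI [of _ f]) (use f in auto)
  next
    case (insert a Z)
    then obtain xs g where g: "g holomorphic_on S" "set xs \<subseteq> Z"
      "\<And>z. z \<in> S \<Longrightarrow> f z = (\<Prod>x\<leftarrow>xs. z - x) * g z" "\<And>z. z \<in> Z \<Longrightarrow> g z \<noteq> 0"
      by auto
    have "g b \<noteq> 0" using g(3) [OF b(1)] b(2) by auto
    moreover have "a \<in> S" using insert by auto
    ultimately obtain h n where h: "h holomorphic_on S" "\<And>z. z \<in> S \<Longrightarrow> g z = (z - a) ^ n * h z" "h a \<noteq> 0"
      using holomorphic_factor_point [OF g(1) S _ b(1)] by blast
    have "f z = (\<Prod>x\<leftarrow>replicate n a @ xs. z - x) * h z" if "z \<in> S" for z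
      using g(3) [OF that] h(2) [OF that] by (simp add: prod_list_replicate map_replicate)
    moreover have "h z \<noteq> 0" if "z \<in> insert a Z" for z
    proof (cases "z = a")
      case False
      then have "z \<in> Z" "z \<in> S" using that insert.prems by auto
      then show ?thesis using g(4) h(2) by force
    qed (use h in simp)
    ultimately show ?case
      using g(2) h(1) by (intro exI [of _ "replicate n a @ xs"] exI [of _ h]) auto
  qed
  then obtain xs g where "g holomorphic_on S" "set xs \<subseteq> Z"
    and *: "\<forall>z\<in>S. f z = (\<Prod>x\<leftarrow>xs. z - x) * g z" "\<forall>z\<in>Z. g z \<noteq> 0"
    by (elim exE conjE)
  show thesis
  proof (rule that)
    show "f z = (\<Prod>x\<leftarrow>xs. z - x) * g z" if "z \<in> S" for z using * that by blast
    show "g z \<noteq> 0" if "z \<in> Z" for z using * that by blast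
  qed fact+
qed

lemma DERIV_prod_list_linear:
  fixes z :: complex
  assumes "z \<notin> set xs"
  shows "((\<lambda>z. \<Prod>x\<leftarrow>xs. z - x) has_field_derivative (\<Prod>x\<leftarrow>xs. z - x) * (\<Sum>x\<leftarrow>xs. 1 / (z - x))) (at z)"
  using assms
proof (induction xs)
  case (Cons a xs)
  then have "z - a \<noteq> 0" by auto
  let ?P = "\<Prod>x\<leftarrow>xs. z - x" and ?S = "\<Sum>x\<leftarrow>xs. 1 / (z - x)"
  have "((\<lambda>z. (z - a) * (\<Prod>x\<leftarrow>xs. z - x)) has_field_derivative (z - a) * (?P * ?S) + 1 * ?P) (at z)"
  proof (rule DERIV_mult')
    show "((\<lambda>z. z - a) has_field_derivative 1) (at z)"
      by (auto intro!: derivative_eq_intros)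
  qed (use Cons in simp)
  moreover have "(z - a) * (?P * ?S) + 1 * ?P = ((z - a) * ?P) * (1 / (z - a) + ?S)"
    using \<open>z - a \<noteq> 0\<close> by (simp add: distrib_left)
  ultimately show ?case by (simp only: list.map prod_list.Cons sum_list.Cons)
qed simp

lemma norm_prod_list_diff_le_1:
  fixes z :: complex
  assumes "\<And>x. x \<in> set xs \<Longrightarrow> norm (z - x) \<le> 1"
  shows "norm (\<Prod>x\<leftarrow>xs. z - x) \<le> 1"
  using assms
proof (induction xs)
  case (Cons a xs)
  then show ?case
    using mult_mono [of "norm (z - a)" 1 "norm (\<Prod>x\<leftarrow>xs. z - x)" 1] by (simp add: norm_mult)
qed simp

lemma ln_norm_prod_list_reals:
  assumes "\<And>x. x \<in> set xs \<Longrightarrow> x \<in> \<real> \<and> 0 < Re x" "0 < y"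
  shows "(\<Prod>x\<leftarrow>xs. - complex_of_real y - x) \<noteq> 0 \<and>
    ln (norm (\<Prod>x\<leftarrow>xs. - complex_of_real y - x)) = (\<Sum>x\<leftarrow>xs. ln (y + Re x))"
  using assms
proof (induction xs)
  case (Cons a xs)
  have "a = of_real (Re a)" "0 < Re a" using Cons.prems by auto
  then have "norm (- complex_of_real y - a) = norm (complex_of_real (- (y + Re a)))"
    by (metis diff_minus_eq_add minus_add_distrib of_real_add of_real_minus uminus_add_conv_diff add.commute)
  also have "\<dots> = y + Re a" using \<open>0 < Re a\<close> \<open>0 < y\<close> by (simp only: norm_of_real)
  finally have "norm (- complex_of_real y - a) = y + Re a" .
  moreover from this have "- complex_of_real y - a \<noteq> 0" using \<open>0 < Re a\<close> \<open>0 < y\<close> by auto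
  moreover have "0 < y + Re a" using \<open>0 < Re a\<close> \<open>0 < y\<close> by simp
  ultimately show ?case
    using Cons by (simp add: norm_mult ln_mult)
qed simp

text \<open>With q = sqrt s, both - ln s \<le> 2/q and 1 \<le> 1/q, so the left side is at most 3
  D/q. This is below 1/q^2 when 9 D^2 s < 1, which explains the 18 in \<epsilon>.\<close>

lemma inverse_dominates_log:
  fixes D :: real
  assumes "1 \<le> D"
  obtains \<epsilon> where "0 < \<epsilon>" "\<epsilon> < 1/2" "\<And>s. \<lbrakk>0 < s; s < 2 * \<epsilon>\<rbrakk> \<Longrightarrow> D * (1 - ln s) < 1 / s"
proof
  define \<epsilon> where "\<epsilon> = 1 / (18 * D\<^sup>2)"
  have "1 \<le> D\<^sup>2" using assms by simp
  then have D2: "0 < D\<^sup>2" by linarith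
  then have "1 / (18 * D\<^sup>2) \<le> 1 / (18 * 1)"
    using \<open>1 \<le> D\<^sup>2\<close> by (intro divide_left_mono mult_left_mono mult_pos_pos) auto
  then show "0 < \<epsilon>" "\<epsilon> < 1/2" using D2 unfolding \<epsilon>_def by (simp, linarith)
  fix s assume s: "0 < s" "s < 2 * \<epsilon>"
  then have s1: "s < 1" using \<open>\<epsilon> < 1/2\<close> by simp
  define q where "q = sqrt s"
  have q: "0 < q" "q\<^sup>2 = s" using s by (auto simp: q_def)
  have "q\<^sup>2 < 1" using q s1 by simp
  then have "q < 1" using q(1) power2_less_imp_less [of q 1] by simp
  have "(3 * D * q)\<^sup>2 < 1\<^sup>2"
    using s q assms by (simp add: power_mult_distrib \<epsilon>_def field_simps)
  then have "3 * D * q < 1" by (rule power2_less_imp_less) simp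
  then have 3: "D * 3 * q < 1" by (simp add: mult_ac)
  have "ln (1 / q) \<le> 1 / q" using q by (intro ln_bound) simp
  moreover have "ln s = 2 * ln q" using q by (simp flip: q(2) add: ln_realpow)
  ultimately have "- ln s \<le> 2 / q" using q by (simp add: ln_div)
  moreover have "1 \<le> 1 / q" using q \<open>q < 1\<close> by simp
  ultimately have "1 - ln s \<le> 3 / q" by (simp add: add_divide_distrib [symmetric] diff_divide_distrib [symmetric])
  then have "D * (1 - ln s) \<le> D * (3 / q)" using assms by (intro mult_left_mono) auto
  also have "\<dots> = D * 3 * q / q\<^sup>2" using q(1) by (simp add: power2_eq_square)
  also have "\<dots> < 1 / q\<^sup>2" using 3 q(1) by (intro divide_strict_right_mono) auto
  finally show "D * (1 - ln s) < 1 / s" using q by simp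
qed

text \<open>Minimum principle by way of 1/f. The maximum of 1/|f| on the circle is attained, which
  keeps the inequality strict.\<close>

lemma holomorphic_gt_1_in_ball:
  assumes f: "f holomorphic_on ball 0 1" and f0: "\<And>z. z \<in> cball 0 (1/2) \<Longrightarrow> f z \<noteq> 0"
    and f1: "\<And>z. norm z = 1/2 \<Longrightarrow> 1 < norm (f z)" and z: "z \<in> cball 0 (1/2)"
  shows "1 < norm (f z)"
proof -
  have cont: "continuous_on (cball 0 (1/2)) (\<lambda>z. inverse (f z))"
    by (intro continuous_on_inverse holomorphic_on_imp_continuous_on holomorphic_on_subset [OF f])
       (use f0 in auto)
  have "continuous_on (sphere 0 (1/2)) (\<lambda>z. norm (inverse (f z)))"
    by (intro continuous_on_norm continuous_on_subset [OF cont]) auto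
  moreover have "sphere 0 (1/2 :: real) \<noteq> ({} :: complex set)" by simp
  ultimately obtain m where m: "m \<in> sphere 0 (1/2 :: real)"
    "\<And>x. x \<in> sphere 0 (1/2) \<Longrightarrow> norm (inverse (f x)) \<le> norm (inverse (f m))"
    using continuous_attains_sup [OF compact_sphere] by blast
  have "norm (inverse (f z)) \<le> norm (inverse (f m))"
  proof (rule maximum_modulus_frontier [of "\<lambda>z. inverse (f z)" "cball 0 (1/2)" _ z])
    show "(\<lambda>z. inverse (f z)) holomorphic_on interior (cball 0 (1/2))"
      by (intro holomorphic_intros holomorphic_on_subset [OF f]) (use f0 interior_subset in auto)
    show "continuous_on (closure (cball 0 (1/2))) (\<lambda>z. inverse (f z))"
      using cont by simp
  qed (use m z in auto)
  moreover have "norm (inverse (f m)) < 1"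
    using f1 [of m] m(1) by (simp add: norm_inverse inverse_less_1_iff)
  ultimately have "inverse (norm (f z)) < 1" by (simp add: norm_inverse)
  then show ?thesis using f0 [OF z] by (simp add: inverse_less_1_iff)
qed

text \<open>Write \<open>g = P h\<close> with \<open>P\<close> the monic polynomial with the zeros of \<open>g\<close>.  At a 1-point
  \<open>- y\<close> the size of \<open>ln |h|\<close> is \<open>- ln |P|\<close>, which is only logarithmic in the distances
  \<open>y + x\<close> to the zeros, so that \<open>P' / P\<close>, of size \<open>1 / (y + x)\<close>, dominates \<open>h' / h\<close> by
  the Harnack estimate for \<open>h\<close>.\<close>

lemma Re_log_deriv_neg_before_one_point:
  obtains \<epsilon> where "0 < \<epsilon>" "\<epsilon> < 1/8"
    "\<And>g y t. \<lbrakk>g holomorphic_on ball 0 1;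
      \<And>z. z \<in> cball 0 (1/2) \<Longrightarrow> g z = 0 \<Longrightarrow> z \<in> \<real> \<and> 0 < Re z \<and> Re z < \<epsilon>;
      \<And>z. norm z = 1/2 \<Longrightarrow> 1 < norm (g z);
      0 < y; y < \<epsilon>; g (- of_real y) = 1; 0 \<le> t; t \<le> y\<rbrakk>
      \<Longrightarrow> Re (deriv g (- of_real t) / g (- of_real t)) < 0"
proof -
  obtain C where C: "1 \<le> C"
    "\<And>f w R z. \<lbrakk>0 < R; f holomorphic_on ball w R; \<And>z. z \<in> ball w R \<Longrightarrow> f z \<noteq> 0 \<and> f z \<noteq> 1;
       z \<in> cball w (R/2)\<rbrakk> \<Longrightarrow> norm (deriv f z / f z) \<le> C * log_size (f w) / R"
    using norm_deriv_div_omitting_disc by blast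
  \<comment> \<open>The estimate of h'/h on radius 3/8 costs C / (3/8) = 8/3 C, so that 3 C leaves a
    margin.\<close>
  have "1 \<le> 3 * C" using C(1) by simp
  then obtain \<epsilon>' where \<epsilon>': "0 < \<epsilon>'" "\<epsilon>' < 1/2" "\<And>s. \<lbrakk>0 < s; s < 2 * \<epsilon>'\<rbrakk> \<Longrightarrow> 3 * C * (1 - ln s) < 1 / s"
    by (rule inverse_dominates_log) blast
  define \<epsilon> where "\<epsilon> = min \<epsilon>' (1/16)"
  show thesis
  proof
    show "0 < \<epsilon>" "\<epsilon> < 1/8" using \<epsilon>' by (auto simp: \<epsilon>_def)
    fix g y t
    assume g: "g holomorphic_on ball 0 1"
      and zeros: "\<And>z. z \<in> cball 0 (1/2) \<Longrightarrow> g z = 0 \<Longrightarrow> z \<in> \<real> \<and> 0 < Re z \<and> Re z < \<epsilon>"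
      and g1: "\<And>z. norm z = 1/2 \<Longrightarrow> 1 < norm (g z)"
      and y: "0 < y" "y < \<epsilon>" and gy: "g (- of_real y) = 1" and t: "0 \<le> t" "t \<le> y"
    define Z where "Z = {z \<in> cball 0 (1/2). g z = 0}"
    have half: "(1/2::complex) \<in> ball 0 1" "g (1/2) \<noteq> 0" using g1 [of "1/2"] by auto
    have "finite Z"
    proof (cases "g constant_on ball 0 1")
      case True
      then have "g z \<noteq> 0" if "z \<in> ball 0 1" for z
        using half that by (auto simp: constant_on_def)
      then have "Z = {}" by (auto simp: Z_def)
      then show ?thesis by simp
    next
      case False
      then show ?thesis
        unfolding Z_def by (intro holomorphic_compact_finite_zeros [OF g]) auto
    qed
    have "Z \<subseteq> ball 0 1" by (auto simp: Z_def)
    obtain xs h where h: "h holomorphic_on ball 0 1" and xsZ: "set xs \<subseteq> Z"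
      and gh: "\<And>z. z \<in> ball 0 1 \<Longrightarrow> g z = (\<Prod>x\<leftarrow>xs. z - x) * h z" and hZ: "\<And>z. z \<in> Z \<Longrightarrow> h z \<noteq> 0"
      by (rule holomorphic_factor_finite [OF g open_ball connected_ball half
            \<open>finite Z\<close> \<open>Z \<subseteq> ball 0 1\<close>]) (rule that)
    have xs: "x \<in> \<real> \<and> 0 < Re x \<and> Re x < \<epsilon>" if "x \<in> set xs" for x
      using that xsZ zeros by (auto simp: Z_def)
    have h0: "h z \<noteq> 0" if "z \<in> cball 0 (1/2)" for z
    proof (cases "g z = 0")
      case True
      then show ?thesis using that hZ by (simp add: Z_def)
    next
      case False
      then show ?thesis using gh [of z] that by auto
    qed
    have h1: "1 < norm (h z)" if "norm z = 1/2" for z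
    proof -
      have "norm (z - x) \<le> 1" if "x \<in> set xs" for x
      proof -
        have "norm x = \<bar>Re x\<bar>" using xs [OF that] by (metis in_Reals_norm real_norm_def)
        then have "norm x \<le> 1/2" using xs [OF that] \<epsilon>' by (simp add: \<epsilon>_def)
        then show ?thesis using norm_triangle_ineq4 [of z x] \<open>norm z = 1/2\<close> by simp
      qed
      then have "norm (\<Prod>x\<leftarrow>xs. z - x) \<le> 1" by (rule norm_prod_list_diff_le_1)
      then have "norm (g z) \<le> norm (h z)"
        using gh [of z] that by (simp add: norm_mult mult_left_le_one_le)
      then show ?thesis using g1 [OF that] by linarith
    qed
    \<comment> \<open>This serves twice: h omits 0 and 1 near -y, so the Harnack estimate applies,
      and ln |h| is positive.\<close>
    have big: "1 < norm (h z)" if "z \<in> cball 0 (1/2)" for z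
      by (rule holomorphic_gt_1_in_ball [OF h h0 h1 that])
    define w where "w = - complex_of_real y"
    have y': "y < 1/8" using y by (simp add: \<epsilon>_def)
    \<comment> \<open>As y < 1/8, radius 3/8 fits into |z| \<le> 1/2, and - t is within half that
      radius of - y.\<close>
    have sub: "ball w (3/8) \<subseteq> cball 0 (1/2)"
    proof
      fix x assume "x \<in> ball w (3/8)"
      moreover have "norm x \<le> norm w + norm (w - x)"
        using norm_triangle_ineq4 [of w "w - x"] by simp
      ultimately show "x \<in> cball 0 (1/2)" using y y' by (simp add: w_def dist_norm)
    qed
    have "norm (deriv h (- of_real t) / h (- of_real t)) \<le> C * log_size (h w) / (3/8)"
    proof (rule C(2))
      show "h holomorphic_on ball w (3/8)"
        by (rule holomorphic_on_subset [OF h]) (use sub in \<open>auto dest!: subsetD\<close>)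
      show "h z \<noteq> 0 \<and> h z \<noteq> 1" if "z \<in> ball w (3/8)" for z
      proof -
        have "1 < norm (h z)" using that sub by (intro big) blast
        then show ?thesis by auto
      qed
      have "norm (w - (- of_real t)) = \<bar>t - y\<bar>"
        unfolding w_def by (metis norm_of_real of_real_diff add.commute diff_minus_eq_add uminus_add_conv_diff)
      then show "- of_real t \<in> cball w (3/8/2)" using y' t by (simp add: dist_norm)
    qed simp
    moreover have "(\<Prod>x\<leftarrow>xs. w - x) \<noteq> 0" "ln (norm (\<Prod>x\<leftarrow>xs. w - x)) = (\<Sum>x\<leftarrow>xs. ln (y + Re x))"
      using ln_norm_prod_list_reals [of xs y] xs y by (auto simp: w_def)
    moreover have w_in: "w \<in> ball 0 1" "w \<in> cball 0 (1/2)" using y y' by (auto simp: w_def)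
    moreover have "(\<Prod>x\<leftarrow>xs. w - x) * h w = 1" using gh [OF w_in(1)] gy by (simp add: w_def)
    ultimately have ln_h: "ln (norm (h w)) = - (\<Sum>x\<leftarrow>xs. ln (y + Re x))"
    proof -
      have "norm (\<Prod>x\<leftarrow>xs. w - x) * norm (h w) = 1"
        using \<open>(\<Prod>x\<leftarrow>xs. w - x) * h w = 1\<close> by (metis norm_mult norm_one)
      then have "ln (norm (\<Prod>x\<leftarrow>xs. w - x) * norm (h w)) = 0" by simp
      then show ?thesis
        using \<open>(\<Prod>x\<leftarrow>xs. w - x) \<noteq> 0\<close> h0 [OF w_in(2)] \<open>ln (norm (\<Prod>x\<leftarrow>xs. w - x)) = _\<close>
        by (simp add: ln_mult)
    qed
    \<comment> \<open>Without zeros the product is 1 and h w = 1, against |h| > 1. At least one term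
      is needed to absorb the summand 1 of \<open>log_size\<close> into the sum below.\<close>
    have "xs \<noteq> []"
      using \<open>(\<Prod>x\<leftarrow>xs. w - x) * h w = 1\<close> big [OF w_in(2)] by auto
    have "0 < ln (norm (h w))" using big [OF w_in(2)] by (rule ln_gt_zero)
    then have "log_size (h w) = 1 + (\<Sum>x\<leftarrow>xs. - ln (y + Re x))"
      by (simp add: log_size_def ln_h uminus_sum_list_map o_def)
    also have "\<dots> \<le> (\<Sum>x\<leftarrow>xs. 1 - ln (y + Re x))"
      using \<open>xs \<noteq> []\<close> by (cases xs) (auto simp: sum_list_subtractf sum_list_triv uminus_sum_list_map o_def)
    finally have size: "log_size (h w) \<le> (\<Sum>x\<leftarrow>xs. 1 - ln (y + Re x))" .
    have "Re (\<Sum>x\<leftarrow>xs. 1 / (- complex_of_real t - x)) \<le> - 3 * C * (\<Sum>x\<leftarrow>xs. 1 - ln (y + Re x))"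
      using xs
    proof (induction xs)
      case (Cons a xs)
      have a: "a = of_real (Re a)" "0 < Re a" "Re a < \<epsilon>" using Cons.prems by auto
      have "- complex_of_real t - a = of_real (- (t + Re a))"
        using a(1) by (metis add.commute diff_conv_add_uminus minus_add_distrib of_real_add of_real_minus)
      then have "1 / (- complex_of_real t - a) = of_real (- (1 / (t + Re a)))"
        by (simp only: of_real_divide of_real_minus of_real_1 divide_minus_right)
      then have "Re (1 / (- complex_of_real t - a)) = - (1 / (t + Re a))"
        by (simp only: Re_complex_of_real)
      \<comment> \<open>As t \<le> y, each term of P'/P at - t is at least as large in modulus as at
        - y, where the size of h is known.\<close>
      moreover have "1 / (y + Re a) \<le> 1 / (t + Re a)"
        using t a y by (intro divide_left_mono) auto
      moreover have "3 * C * (1 - ln (y + Re a)) < 1 / (y + Re a)"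
        using a y by (intro \<epsilon>'(3)) (auto simp: \<epsilon>_def)
      ultimately have "Re (1 / (- complex_of_real t - a)) \<le> - 3 * C * (1 - ln (y + Re a))"
        by linarith
      moreover have "Re (\<Sum>x\<leftarrow>xs. 1 / (- complex_of_real t - x)) \<le> - 3 * C * (\<Sum>x\<leftarrow>xs. 1 - ln (y + Re x))"
        using Cons by simp
      ultimately show ?case by (simp only: list.map sum_list.Cons plus_complex.sel distrib_left)
    qed simp
    also have "\<dots> \<le> - 3 * C * log_size (h w)"
      using size C(1) by (simp add: mult_left_mono)
    finally have "Re (\<Sum>x\<leftarrow>xs. 1 / (- complex_of_real t - x)) \<le> - 3 * C * log_size (h w)" .
    moreover have "Re (deriv h (- of_real t) / h (- of_real t)) \<le> C * log_size (h w) / (3/8)"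
      using \<open>norm (deriv h (- of_real t) / h (- of_real t)) \<le> _\<close> complex_Re_le_cmod order_trans by blast
    moreover have "0 < C * log_size (h w)" using C(1) by simp
    ultimately have neg: "Re ((\<Sum>x\<leftarrow>xs. 1 / (- complex_of_real t - x)) + deriv h (- of_real t) / h (- of_real t)) < 0"
      by simp
    let ?z = "- complex_of_real t" and ?P = "\<lambda>z. \<Prod>x\<leftarrow>xs. z - x"
    have z_in: "?z \<in> ball 0 1" "?z \<in> cball 0 (1/2)" using t y' by auto
    have z_xs: "?z \<notin> set xs" using xs [of ?z] t by auto
    have "((\<lambda>z. ?P z * h z) has_field_derivative
        ?P ?z * deriv h ?z + ?P ?z * (\<Sum>x\<leftarrow>xs. 1 / (?z - x)) * h ?z) (at ?z)"
      by (rule DERIV_mult' [OF DERIV_prod_list_linear [OF z_xs] holomorphic_derivI [OF h open_ball z_in(1)]])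
    then have "(g has_field_derivative
        ?P ?z * deriv h ?z + ?P ?z * (\<Sum>x\<leftarrow>xs. 1 / (?z - x)) * h ?z) (at ?z)"
      by (rule has_field_derivative_transform_within_open [OF _ open_ball z_in(1)]) (use gh in simp)
    then have g': "deriv g ?z = ?P ?z * deriv h ?z + ?P ?z * (\<Sum>x\<leftarrow>xs. 1 / (?z - x)) * h ?z"
      by (rule DERIV_imp_deriv)
    have "?P ?z \<noteq> 0" using z_xs by (auto simp: prod_list_zero_iff)
    then have "deriv g ?z / g ?z = (\<Sum>x\<leftarrow>xs. 1 / (?z - x)) + deriv h ?z / h ?z"
      using h0 [OF z_in(2)] by (simp add: g' gh [OF z_in(1)] add_divide_distrib)
    then show "Re (deriv g ?z / g ?z) < 0" using neg by simp
  qed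
qed

text \<open>The derivative of |g(-t)|^2 with respect to t is -2 |g|^2 Re (g'/g).\<close>

lemma norm_increasing_before_one_point:
  assumes "a < b"
    and hol: "g holomorphic_on S" "open S" "\<And>t. \<lbrakk>a \<le> t; t \<le> b\<rbrakk> \<Longrightarrow> - complex_of_real t \<in> S"
    and neg: "\<And>t. \<lbrakk>a \<le> t; t \<le> b\<rbrakk> \<Longrightarrow> Re (deriv g (- of_real t) / g (- of_real t)) < 0"
  shows "norm (g (- of_real a)) < norm (g (- of_real b))"
proof -
  define u where "u = (\<lambda>t. (Re (g (- of_real t)))\<^sup>2 + (Im (g (- of_real t)))\<^sup>2)"
  have "\<exists>d. (u has_real_derivative d) (at t) \<and> 0 < d" if t: "a \<le> t" "t \<le> b" for t
  proof -
    let ?z = "- complex_of_real t"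
    have "(g has_field_derivative deriv g ?z) (at ?z)"
      using holomorphic_derivI [OF hol(1,2) hol(3) [OF t]] .
    moreover have "((\<lambda>t. - complex_of_real t) has_vector_derivative - 1) (at t)"
      by (auto intro!: derivative_eq_intros)
    ultimately have "(g \<circ> (\<lambda>t. - complex_of_real t) has_vector_derivative (- 1 * deriv g ?z)) (at t)"
      by (intro field_vector_diff_chain_at)
    then have *: "((\<lambda>t. g (- complex_of_real t)) has_vector_derivative - deriv g ?z) (at t)"
      by (simp add: o_def)
    define R I where "R = (\<lambda>t. Re (g (- complex_of_real t)))" and "I = (\<lambda>t. Im (g (- complex_of_real t)))"
    have "(R has_real_derivative - Re (deriv g ?z)) (at t)"
      using bounded_linear.has_vector_derivative [OF bounded_linear_Re *]
      by (simp add: has_real_derivative_iff_has_vector_derivative R_def)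
    moreover have "(I has_real_derivative - Im (deriv g ?z)) (at t)"
      using bounded_linear.has_vector_derivative [OF bounded_linear_Im *]
      by (simp add: has_real_derivative_iff_has_vector_derivative I_def)
    ultimately have "((\<lambda>t. (R t)\<^sup>2 + (I t)\<^sup>2) has_real_derivative
        - 2 * (R t * Re (deriv g ?z) + I t * Im (deriv g ?z))) (at t)"
      by (auto intro!: derivative_eq_intros simp: algebra_simps)
    then have "(u has_real_derivative
        - 2 * (Re (g ?z) * Re (deriv g ?z) + Im (g ?z) * Im (deriv g ?z))) (at t)"
      by (simp only: u_def R_def I_def)
    moreover have "Re (g ?z) * Re (deriv g ?z) + Im (g ?z) * Im (deriv g ?z) < 0"
      using neg [OF t] sum_power2_ge_zero [of "Re (g ?z)" "Im (g ?z)"]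
      by (auto simp: Re_divide divide_less_0_iff mult.commute)
    ultimately show ?thesis
      by (intro exI [of _ "- 2 * (Re (g ?z) * Re (deriv g ?z) + Im (g ?z) * Im (deriv g ?z))"]) simp
  qed
  then have "u a < u b"
    using DERIV_pos_imp_increasing [OF \<open>a < b\<close>] by blast
  then show ?thesis by (simp add: u_def cmod_def)
qed

text \<open>Zeros x < y of f would give |g| = 1 at both - x and - y for g(z) = 1 - f(-z), against
  strict increase. A multiple zero would give g' = 0 at a 1-point, where Re (g'/g) < 0. The bound 3
  for |f| yields |g| \<ge> 2, which confines the zeros of g and makes |g| > 1 on |z| = 1/2.\<close>

lemma radial_family_unique_zero:
  obtains \<epsilon> where "0 < \<epsilon>" "\<epsilon> < 1/8"
    "\<And>f a b. \<lbrakk>f \<in> radial_family; \<And>z. \<lbrakk>\<epsilon> \<le> norm z; norm z \<le> 1/2\<rbrakk> \<Longrightarrow> 3 \<le> norm (f z);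
      a \<in> cball 0 (1/2); b \<in> cball 0 (1/2); f a = 0; f b = 0\<rbrakk> \<Longrightarrow> a = b \<and> deriv f a \<noteq> 0"
proof (rule Re_log_deriv_neg_before_one_point)
  fix \<epsilon> :: real assume \<epsilon>: "0 < \<epsilon>" "\<epsilon> < 1/8" and key:
    "\<And>g y t. \<lbrakk>g holomorphic_on ball 0 1;
      \<And>z. z \<in> cball 0 (1/2) \<Longrightarrow> g z = 0 \<Longrightarrow> z \<in> \<real> \<and> 0 < Re z \<and> Re z < \<epsilon>;
      \<And>z. norm z = 1/2 \<Longrightarrow> 1 < norm (g z);
      0 < y; y < \<epsilon>; g (- of_real y) = 1; 0 \<le> t; t \<le> y\<rbrakk>
      \<Longrightarrow> Re (deriv g (- of_real t) / g (- of_real t)) < 0"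
  show thesis
  proof
    fix f a b
    assume f: "f \<in> radial_family" and big: "\<And>z. \<lbrakk>\<epsilon> \<le> norm z; norm z \<le> 1/2\<rbrakk> \<Longrightarrow> 3 \<le> norm (f z)"
      and ab: "a \<in> cball 0 (1/2)" "b \<in> cball 0 (1/2)" "f a = 0" "f b = 0"
    define g where "g = (\<lambda>z. 1 - f (- z))"
    have g: "g \<in> radial_family"
      unfolding g_def by (rule radial_family_reflect [OF f])
    have big_g: "2 \<le> norm (g z)" if "\<epsilon> \<le> norm z" "norm z \<le> 1/2" for z
      using big [of "- z"] norm_triangle_ineq2 [of "f (- z)" 1] that
      by (simp add: g_def norm_minus_commute)
    have norm_Re: "norm z = Re z" if "z \<in> \<real>" "0 < Re z" for z
      using that by (metis abs_of_pos in_Reals_norm)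
    have zeros: "z \<in> \<real> \<and> 0 < Re z \<and> Re z < \<epsilon>" if "z \<in> cball 0 (1/2)" "g z = 0" for z
    proof -
      have z: "z \<in> \<real>" "0 < Re z" using g that by (auto simp: radial_family_def)
      have "norm z < \<epsilon>" using big_g [of z] that by (force simp: not_le [symmetric])
      then show ?thesis using z norm_Re by simp
    qed
    have sphere: "1 < norm (g z)" if "norm z = 1/2" for z
      using big_g [of z] that \<epsilon> by simp
    have pos: "\<exists>y. c = of_real y \<and> 0 < y \<and> y < \<epsilon> \<and> g (- of_real y) = 1"
      if "c \<in> cball 0 (1/2)" "f c = 0" for c
    proof -
      have c: "c \<in> \<real>" "0 < Re c" using f that by (auto simp: radial_family_def)
      have "norm c < \<epsilon>" using big [of c] that by (force simp: not_le [symmetric])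
      then have "c = of_real (Re c) \<and> 0 < Re c \<and> Re c < \<epsilon> \<and> g (- of_real (Re c)) = 1"
        using c norm_Re [OF c] that by (simp add: g_def)
      then show ?thesis by blast
    qed
    have less: False if xy: "0 < x" "x < y" "y < \<epsilon>" "g (- of_real x) = 1" "g (- of_real y) = 1" for x y
    proof -
      have "norm (g (- of_real x)) < norm (g (- of_real y))"
      proof (rule norm_increasing_before_one_point [OF xy(2) radial_family_holomorphic [OF g] open_ball])
        show "Re (deriv g (- of_real t) / g (- of_real t)) < 0" if "x \<le> t" "t \<le> y" for t
          by (rule key [OF radial_family_holomorphic [OF g] zeros sphere _ xy(3) xy(5)]) (use that xy in auto)
      qed (use xy \<epsilon> in auto)
      then show False using xy by simp
    qed
    obtain x y where x: "a = of_real x" "0 < x" "x < \<epsilon>" "g (- of_real x) = 1"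
      and y: "b = of_real y" "0 < y" "y < \<epsilon>" "g (- of_real y) = 1"
      using pos [OF ab(1,3)] pos [OF ab(2,4)] by blast
    have "x = y"
      using less [OF x(2) _ y(3) x(4) y(4)] less [OF y(2) _ x(3) y(4) x(4)]
      by (metis linorder_neqE_linordered_idom)
    moreover have "deriv f a \<noteq> 0"
    proof
      assume "deriv f a = 0"
      have "a \<in> ball 0 1" using ab(1) by simp
      then have "(f has_field_derivative 0) (at (- (- a)))"
        using holomorphic_derivI [OF radial_family_holomorphic [OF f] open_ball] \<open>deriv f a = 0\<close> by force
      then have "((\<lambda>z. f (- z)) has_field_derivative 0 * - 1) (at (- a))"
        by (rule DERIV_chain2) (auto intro!: derivative_eq_intros)
      then have "(g has_field_derivative 0) (at (- a))"
        unfolding g_def by (auto intro!: derivative_eq_intros)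
      then have "deriv g (- of_real x) = 0"
        using x(1) DERIV_imp_deriv by blast
      moreover have "Re (deriv g (- of_real x) / g (- of_real x)) < 0"
        by (rule key [OF radial_family_holomorphic [OF g] zeros sphere x(2,3,4)]) (use x in auto)
      ultimately show False by simp
    qed
    ultimately show "a = b \<and> deriv f a \<noteq> 0" using x y by simp
  qed (fact \<epsilon>)+
qed

subsection \<open>Spherical convergence\<close>

text \<open>The eventual bound on a compact set is completed by separate bounds for the finitely
  many earlier functions.\<close>

lemma Montel_sequence:
  assumes "open S" and hol: "\<And>k. f k holomorphic_on S" and bdd: "locally_bounded_seq S f"
  obtains l and r :: "nat \<Rightarrow> nat" where "l holomorphic_on S" "strict_mono r"
    "\<And>K. \<lbrakk>compact K; K \<subseteq> S\<rbrakk> \<Longrightarrow> uniform_limit K (f \<circ> r) l sequentially"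
proof (rule Montel [OF \<open>open S\<close>, of "range f" f])
  show "\<exists>B. \<forall>h\<in>range f. \<forall>z\<in>K. norm (h z) \<le> B" if K: "compact K" "K \<subseteq> S" for K
  proof -
    obtain B where "\<forall>\<^sub>F k in sequentially. \<forall>z\<in>K. norm (f k z) \<le> B"
      using bdd K unfolding locally_bounded_seq_def by blast
    then obtain N where B: "\<And>k z. \<lbrakk>N \<le> k; z \<in> K\<rbrakk> \<Longrightarrow> norm (f k z) \<le> B"
      unfolding eventually_sequentially by blast
    have "\<exists>b. \<forall>z\<in>K. norm (f k z) \<le> b" for k
    proof -
      have "continuous_on K (f k)"
        by (rule continuous_on_subset [OF holomorphic_on_imp_continuous_on [OF hol] K(2)])
      then have "bounded (f k ` K)"
        using compact_continuous_image K(1) compact_imp_bounded by blast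
      then show ?thesis by (auto simp: bounded_iff)
    qed
    then have "\<forall>k. \<exists>b. \<forall>z\<in>K. norm (f k z) \<le> b" by blast
    from choice [OF this] obtain b where b: "\<And>k z. z \<in> K \<Longrightarrow> norm (f k z) \<le> b k" by blast
    have "norm (f k z) \<le> Max (insert B (b ` {..<N}))" if "z \<in> K" for k z
    proof (cases "k < N")
      case True
      have "norm (f k z) \<le> b k" by (rule b [OF that])
      also have "\<dots> \<le> Max (insert B (b ` {..<N}))" using True by (intro Max_ge) auto
      finally show ?thesis .
    next
      case False
      then have "norm (f k z) \<le> B" by (intro B that) simp
      also have "\<dots> \<le> Max (insert B (b ` {..<N}))" by (intro Max_ge) auto
      finally show ?thesis .
    qed
    then show ?thesis by blast
  qed
qed (use hol that in auto)

text \<open>Half the chord is at most |z - w|, respectively 1/|z| for the distance to infinity, and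
  arcsin is continuous at 0.\<close>

lemma spherical_dist_Fin_less:
  assumes "0 < e"
  obtains \<delta> where "0 < \<delta>" "\<And>z w. norm (z - w) < \<delta> \<Longrightarrow> \<bar>spherical_dist (Fin z) (Fin w)\<bar> < e"
    "\<And>z. 1 / \<delta> < norm z \<Longrightarrow> \<bar>spherical_dist (Fin z) Infty\<bar> < e"
proof -
  have "continuous (at 0 within {-1..1}) arcsin"
    using continuous_on_arcsin' continuous_on_arcsin [OF continuous_on_id, of "{-1..1}"]
    by (auto simp: continuous_on_eq_continuous_within)
  then obtain d where d: "0 < d" "\<And>x. x \<in> {-1..1} \<Longrightarrow> \<bar>x\<bar> < d \<Longrightarrow> \<bar>arcsin x\<bar> < e / 2"
    using assms unfolding continuous_within_eps_delta
    by (metis arcsin_0 diff_zero dist_real_def half_gt_zero)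
  define \<delta> where "\<delta> = min d 1"
  have \<delta>: "0 < \<delta>" "\<delta> \<le> d" "\<delta> \<le> 1" using d by (auto simp: \<delta>_def)
  have small: "\<bar>2 * arcsin x\<bar> < e" if "0 \<le> x" "x < \<delta>" for x
    using d(2) [of x] that \<delta> by (simp add: abs_mult)
  show thesis
  proof
    show "0 < \<delta>" by fact
    fix z w :: complex assume zw: "norm (z - w) < \<delta>"
    let ?q = "sqrt (1 + (norm z)\<^sup>2) * sqrt (1 + (norm w)\<^sup>2)"
    have "1 * 1 \<le> ?q" by (intro mult_mono) auto
    then have "norm (z - w) / ?q \<le> norm (z - w) / 1" by (intro divide_left_mono) auto
    then have "\<bar>2 * arcsin (norm (z - w) / ?q)\<bar> < e"
      using zw by (intro small) auto
    then show "\<bar>spherical_dist (Fin z) (Fin w)\<bar> < e"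
      by (simp add: spherical_dist_def)
  next
    fix z :: complex assume z: "1 / \<delta> < norm z"
    have "0 < norm z" using z \<delta> by (metis less_trans zero_less_divide_1_iff)
    have "norm z \<le> sqrt (1 + (norm z)\<^sup>2)" by (intro real_le_rsqrt) simp
    moreover from this have "0 < sqrt (1 + (norm z)\<^sup>2)" using \<open>0 < norm z\<close> by linarith
    ultimately have "1 / sqrt (1 + (norm z)\<^sup>2) \<le> 1 / norm z"
      using \<open>0 < norm z\<close> by (intro divide_left_mono mult_pos_pos) auto
    also have "1 / norm z < \<delta>"
      using z \<delta> \<open>0 < norm z\<close> by (simp add: field_simps)
    finally have "\<bar>2 * arcsin (1 / sqrt (1 + (norm z)\<^sup>2))\<bar> < e"
      by (intro small) auto
    then show "\<bar>spherical_dist (Fin z) Infty\<bar> < e"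
      by (simp add: spherical_dist_def)
  qed
qed

lemma spherically_converges_on_finite:
  assumes "\<And>K. \<lbrakk>compact K; K \<subseteq> S\<rbrakk> \<Longrightarrow> uniform_limit K f l sequentially"
  shows "spherically_converges_on S f (\<lambda>z. Fin (l z))"
  unfolding spherically_converges_on_def
proof (intro allI impI uniform_limitI)
  fix K :: "complex set" and e :: real assume K: "compact K \<and> K \<subseteq> S" and "0 < e"
  obtain \<delta> where \<delta>: "0 < \<delta>" "\<And>z w. norm (z - w) < \<delta> \<Longrightarrow> \<bar>spherical_dist (Fin z) (Fin w)\<bar> < e"
    using spherical_dist_Fin_less [OF \<open>0 < e\<close>] by metis
  have "\<forall>\<^sub>F n in sequentially. \<forall>z\<in>K. dist (f n z) (l z) < \<delta>"
    using uniform_limitD assms K \<delta>(1) by blast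
  then show "\<forall>\<^sub>F n in sequentially. \<forall>z\<in>K. dist (spherical_dist (Fin (f n z)) (Fin (l z))) 0 < e"
    by eventually_elim (use \<delta>(2) in \<open>simp add: dist_norm\<close>)
qed

lemma spherically_converges_on_Infty:
  assumes "locally_divergent_seq S f"
  shows "spherically_converges_on S f (\<lambda>_. Infty)"
  unfolding spherically_converges_on_def
proof (intro allI impI uniform_limitI)
  fix K :: "complex set" and e :: real assume K: "compact K \<and> K \<subseteq> S" and "0 < e"
  obtain \<delta> where \<delta>: "0 < \<delta>" "\<And>z. 1 / \<delta> < norm z \<Longrightarrow> \<bar>spherical_dist (Fin z) Infty\<bar> < e"
    using spherical_dist_Fin_less [OF \<open>0 < e\<close>] by metis
  have "\<forall>\<^sub>F n in sequentially. \<forall>z\<in>K. 1 / \<delta> + 1 \<le> norm (f n z)"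
    using assms K unfolding locally_divergent_seq_def by blast
  then show "\<forall>\<^sub>F n in sequentially. \<forall>z\<in>K. dist (spherical_dist (Fin (f n z)) Infty) 0 < e"
  proof eventually_elim
    case (elim n)
    have "1 / \<delta> < norm (f n z)" if "z \<in> K" for z
      using elim that by fastforce
    then show ?case using \<delta>(2) by simp
  qed
qed

lemma has_convergent_subseq_on_of_locally_bounded:
  assumes "open S" "\<And>k. f k holomorphic_on S" "strict_mono r" "locally_bounded_seq S (f \<circ> r)"
  shows "has_convergent_subseq_on S f"
proof -
  have "(f \<circ> r) k holomorphic_on S" for k using assms by simp
  then obtain l and s :: "nat \<Rightarrow> nat" where ls: "strict_mono s"
    "\<And>K. \<lbrakk>compact K; K \<subseteq> S\<rbrakk> \<Longrightarrow> uniform_limit K ((f \<circ> r) \<circ> s) l sequentially"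
    using Montel_sequence [OF assms(1) _ assms(4)] by metis
  have "spherically_converges_on S (f \<circ> (r \<circ> s)) (\<lambda>z. Fin (l z))"
    using spherically_converges_on_finite [OF ls(2)] by (simp add: comp_assoc)
  moreover have "strict_mono (r \<circ> s)" using assms(3) ls(1) by (rule strict_mono_o)
  ultimately show ?thesis unfolding has_convergent_subseq_on_def by blast
qed

lemma normal_on_radial_family: "normal_on (ball 0 1 - {0}) radial_family"
  unfolding normal_on_def
proof (intro allI impI)
  fix f :: "nat \<Rightarrow> complex \<Rightarrow> complex" assume f: "range f \<subseteq> radial_family"
  obtain r :: "nat \<Rightarrow> nat" where r: "strict_mono r"
    "locally_bounded_seq (ball 0 1 - {0}) (f \<circ> r) \<or> locally_divergent_seq (ball 0 1 - {0}) (f \<circ> r)"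
    by (rule radial_family_dichotomy [OF f]) (rule that)
  show "has_convergent_subseq_on (ball 0 1 - {0}) f"
    using r(2)
  proof
    assume "locally_bounded_seq (ball 0 1 - {0}) (f \<circ> r)"
    moreover have "f k holomorphic_on ball 0 1 - {0}" for k
      by (rule holomorphic_on_subset [OF radial_family_holomorphic]) (use f in auto)
    ultimately show ?thesis
      using r(1) by (intro has_convergent_subseq_on_of_locally_bounded [of _ f r]) auto
  next
    assume "locally_divergent_seq (ball 0 1 - {0}) (f \<circ> r)"
    from spherically_converges_on_Infty [OF this] r(1) show ?thesis
      unfolding has_convergent_subseq_on_def by blast
  qed
qed

section \<open>Passing from the punctured disc to the disc\<close>

lemma locally_bounded_seq_fill_puncture:
  assumes hol: "\<And>k. f k holomorphic_on ball 0 1" and bdd: "locally_bounded_seq (ball 0 1 - {0}) f"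
  shows "locally_bounded_seq (ball 0 1) f"
  unfolding locally_bounded_seq_def
proof (intro allI impI, elim conjE)
  fix K :: "complex set" assume K: "compact K" "K \<subseteq> ball 0 1"
  \<comment> \<open>The part of \<open>K\<close> outside |z| < 1/2 together with the full circle |z|
    = 1/2, from which the maximum principle reaches the rest of \<open>K\<close>.\<close>
  have "compact (K - ball 0 (1/2) \<union> sphere 0 (1/2)) \<and> K - ball 0 (1/2) \<union> sphere 0 (1/2) \<subseteq> ball 0 1 - {0}"
    using K by (auto intro!: compact_Un compact_diff)
  then obtain B where "\<forall>\<^sub>F k in sequentially. \<forall>z\<in>K - ball 0 (1/2) \<union> sphere 0 (1/2). norm (f k z) \<le> B"
    using bdd unfolding locally_bounded_seq_def by blast
  then have "\<forall>\<^sub>F k in sequentially. \<forall>z\<in>K. norm (f k z) \<le> B"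
  proof eventually_elim
    case (elim k)
    show ?case
    proof
      fix z assume z: "z \<in> K"
      show "norm (f k z) \<le> B"
      proof (cases "z \<in> ball 0 (1/2)")
        case True
        show ?thesis
        proof (rule maximum_modulus_frontier [of "f k" "cball 0 (1/2)" _ z])
          show "f k holomorphic_on interior (cball 0 (1/2))"
            by (rule holomorphic_on_subset [OF hol]) (use interior_subset in auto)
          show "continuous_on (closure (cball 0 (1/2))) (f k)"
            by (rule holomorphic_on_imp_continuous_on, rule holomorphic_on_subset [OF hol]) auto
        qed (use True elim in auto)
      qed (use z elim in auto)
    qed
  qed
  then show "\<exists>B. \<forall>\<^sub>F k in sequentially. \<forall>z\<in>K. norm (f k z) \<le> B" ..
qed

text \<open>The maximum principle is applied to 1/f on |z| \<le> 1/2, which is where zeros must be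
  absent.\<close>

lemma locally_divergent_seq_fill_puncture:
  assumes hol: "\<And>k. f k holomorphic_on ball 0 1" and div: "locally_divergent_seq (ball 0 1 - {0}) f"
    and nz: "\<forall>\<^sub>F k in sequentially. \<forall>z\<in>cball 0 (1/2). f k z \<noteq> 0"
  shows "locally_divergent_seq (ball 0 1) f"
  unfolding locally_divergent_seq_def
proof (intro allI impI, elim conjE)
  fix K :: "complex set" and B assume K: "compact K" "K \<subseteq> ball 0 1"
  have "compact (K - ball 0 (1/2) \<union> sphere 0 (1/2)) \<and> K - ball 0 (1/2) \<union> sphere 0 (1/2) \<subseteq> ball 0 1 - {0}"
    using K by (auto intro!: compact_Un compact_diff)
  then have "\<forall>\<^sub>F k in sequentially. \<forall>z\<in>K - ball 0 (1/2) \<union> sphere 0 (1/2). max 1 B \<le> norm (f k z)"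
    using div unfolding locally_divergent_seq_def by blast
  with nz show "\<forall>\<^sub>F k in sequentially. \<forall>z\<in>K. B \<le> norm (f k z)"
  proof eventually_elim
    case (elim k)
    show ?case
    proof
      fix z assume z: "z \<in> K"
      show "B \<le> norm (f k z)"
      proof (cases "z \<in> ball 0 (1/2)")
        case True
        have "norm (inverse (f k z)) \<le> inverse (max 1 B)"
        proof (rule maximum_modulus_frontier [of "\<lambda>z. inverse (f k z)" "cball 0 (1/2)" _ z])
          show "(\<lambda>z. inverse (f k z)) holomorphic_on interior (cball 0 (1/2))"
            by (intro holomorphic_intros holomorphic_on_subset [OF hol])
               (use interior_subset elim in auto)
          show "continuous_on (closure (cball 0 (1/2))) (\<lambda>z. inverse (f k z))"
            by (intro continuous_on_inverse holomorphic_on_imp_continuous_on holomorphic_on_subset [OF hol])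
               (use elim in auto)
          fix x :: complex assume "x \<in> frontier (cball 0 (1/2))"
          then have "max 1 B \<le> norm (f k x)" using elim(2) by auto
          then show "norm (inverse (f k x)) \<le> inverse (max 1 B)"
            unfolding norm_inverse by (intro le_imp_inverse_le) auto
        qed (use True in auto)
        then have "max 1 B \<le> norm (f k z)"
          unfolding norm_inverse by (rule inverse_le_imp_le) (use True elim in auto)
        then show ?thesis by simp
      qed (use z elim in auto)
    qed
  qed
qed

text \<open>A subsequence violating divergence would by the dichotomy be locally bounded off 0 along a
  further subsequence, and then on the whole disc by the maximum principle.\<close>

lemma locally_divergent_of_no_convergent_subseq:
  assumes f: "range f \<subseteq> radial_family" and no: "\<not> has_convergent_subseq_on (ball 0 1) f"
  shows "locally_divergent_seq (ball 0 1 - {0}) f"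
proof (rule ccontr)
  assume "\<not> ?thesis"
  then obtain K B where K: "compact K" "K \<subseteq> ball 0 1 - {0}"
    and nB: "\<not> (\<forall>\<^sub>F k in sequentially. \<forall>z\<in>K. B \<le> norm (f k z))"
    unfolding locally_divergent_seq_def by blast
  obtain r :: "nat \<Rightarrow> nat" where r: "strict_mono r" "\<And>k. \<not> (\<forall>z\<in>K. B \<le> norm (f (r k) z))"
    using not_eventually_sequentiallyD [OF nB] by blast
  have fr: "range (f \<circ> r) \<subseteq> radial_family" using f by auto
  obtain s :: "nat \<Rightarrow> nat" where s: "strict_mono s"
    "locally_bounded_seq (ball 0 1 - {0}) ((f \<circ> r) \<circ> s) \<or> locally_divergent_seq (ball 0 1 - {0}) ((f \<circ> r) \<circ> s)"
    by (rule radial_family_dichotomy [OF fr]) (rule that)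
  from s(2) show False
  proof
    assume "locally_divergent_seq (ball 0 1 - {0}) ((f \<circ> r) \<circ> s)"
    then have "\<forall>\<^sub>F k in sequentially. \<forall>z\<in>K. B \<le> norm (((f \<circ> r) \<circ> s) k z)"
      using K unfolding locally_divergent_seq_def by blast
    then obtain k where "\<forall>z\<in>K. B \<le> norm (((f \<circ> r) \<circ> s) k z)"
      using eventually_happens' [OF sequentially_bot] by blast
    then show False using r(2) [of "s k"] by simp
  next
    have hol: "f k holomorphic_on ball 0 1" for k
      using f radial_family_holomorphic by auto
    assume "locally_bounded_seq (ball 0 1 - {0}) ((f \<circ> r) \<circ> s)"
    then have "locally_bounded_seq (ball 0 1) (f \<circ> (r \<circ> s))"
      unfolding comp_assoc by (intro locally_bounded_seq_fill_puncture) (use hol in auto)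
    then show False
      using no has_convergent_subseq_on_of_locally_bounded
        [of "ball 0 1" f "r \<circ> s", OF open_ball hol strict_mono_o [OF r(1) s(1)]] by blast
  qed
qed

lemma locally_divergent_seq_subseq:
  assumes "locally_divergent_seq S f" "strict_mono r"
  shows "locally_divergent_seq S (f \<circ> r)"
  unfolding locally_divergent_seq_def
proof (intro allI impI)
  fix K B assume "compact K \<and> K \<subseteq> S"
  then have "\<forall>\<^sub>F k in sequentially. \<forall>z\<in>K. B \<le> norm (f k z)"
    using assms(1) unfolding locally_divergent_seq_def by blast
  from eventually_subseq [OF assms(2) this]
  show "\<forall>\<^sub>F k in sequentially. \<forall>z\<in>K. B \<le> norm ((f \<circ> r) k z)" by simp
qed

text \<open>A subsequence without zeros in |z| \<le> 1/2 would tend to infinity on the whole disc,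
  and so converge.\<close>

lemma eventually_zero_of_no_convergent_subseq:
  assumes f: "range f \<subseteq> radial_family" and no: "\<not> has_convergent_subseq_on (ball 0 1) f"
  shows "\<forall>\<^sub>F k in sequentially. \<exists>z\<in>cball 0 (1/2). f k z = 0"
proof (rule ccontr)
  assume "\<not> ?thesis"
  then obtain r :: "nat \<Rightarrow> nat" where r: "strict_mono r" "\<And>k. \<not> (\<exists>z\<in>cball 0 (1/2). f (r k) z = 0)"
    using not_eventually_sequentiallyD by blast
  have "locally_divergent_seq (ball 0 1 - {0}) (f \<circ> r)"
    using locally_divergent_of_no_convergent_subseq [OF assms] r(1) by (rule locally_divergent_seq_subseq)
  moreover have "(f \<circ> r) k holomorphic_on ball 0 1" for k
    using f by (auto intro: radial_family_holomorphic)
  ultimately have "locally_divergent_seq (ball 0 1) (f \<circ> r)"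
    by (intro locally_divergent_seq_fill_puncture) (use r(2) in \<open>auto intro!: always_eventually\<close>)
  from spherically_converges_on_Infty [OF this] r(1) no show False
    unfolding has_convergent_subseq_on_def by blast
qed

text \<open>The value f'(a) removes the singularity of the quotient; it is nonzero exactly when the
  zero is simple.\<close>

lemma holomorphic_divide_simple_zero:
  assumes "f holomorphic_on S" "open S" "a \<in> S" "f a = 0"
  obtains g where "g holomorphic_on S" "\<And>z. f z = (z - a) * g z" "g a = deriv f a"
proof
  define g where "g = (\<lambda>z. if z = a then deriv f a else f z / (z - a))"
  show "g holomorphic_on S"
    by (rule pole_theorem_open_0 [OF assms(1,2), of a]) (use assms(4) in \<open>auto simp: g_def\<close>)
  show "f z = (z - a) * g z" for z
    using assms(4) by (simp add: g_def)
  show "g a = deriv f a" by (simp add: g_def)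
qed

lemma radial_family_no_convergent_subseq:
  assumes f: "range f \<subseteq> radial_family" and no: "\<not> has_convergent_subseq_on (ball 0 1) f"
  obtains a g where "\<And>k. g k holomorphic_on ball 0 1" "\<And>k z. z \<in> ball 0 1 \<Longrightarrow> f k z = (z - a k) * g k z"
    "spherically_converges_on (ball 0 1) g (\<lambda>_. Infty)" "a \<longlonglongrightarrow> 0"
proof -
  have f_in: "f k \<in> radial_family" for k using f by auto
  have hol: "f k holomorphic_on ball 0 1" for k
    using radial_family_holomorphic [OF f_in] .
  have div: "locally_divergent_seq (ball 0 1 - {0}) f"
    by (rule locally_divergent_of_no_convergent_subseq [OF assms])
  \<comment> \<open>Eventually f k has a zero in |z| \<le> 1/2. \<open>P\<close> ties a and g to
    such a zero for those k and leaves the others free.\<close>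
  define P where "P = (\<lambda>k a g. (\<exists>z\<in>cball 0 (1/2). f k z = 0) \<longrightarrow>
    a \<in> cball 0 (1/2) \<and> f k a = 0 \<and> g a = deriv (f k) a)"
  have "\<exists>a g. g holomorphic_on ball 0 1 \<and> (\<forall>z\<in>ball 0 1. f k z = (z - a) * g z) \<and> norm (a::complex) \<le> 2 \<and> P k a g" for k
  proof (cases "\<exists>z\<in>cball 0 (1/2). f k z = 0")
    case True
    then obtain a where a: "a \<in> cball 0 (1/2)" "f k a = 0" by blast
    have "a \<in> ball 0 1" using a(1) by simp
    then obtain g where g: "g holomorphic_on ball 0 1" "\<And>z. f k z = (z - a) * g z" "g a = deriv (f k) a"
      using holomorphic_divide_simple_zero [OF hol open_ball _ a(2)] by blast
    have "norm a \<le> 2" using a(1) by simp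
    then show ?thesis
      using a g by (intro exI [of _ a] exI [of _ g]) (simp_all add: P_def)
  next
    case False
    \<comment> \<open>The default a = 2 lies outside the disc, so that z - a does not vanish there.
      The uniform bound |a| \<le> 2 gives |z - a| \<le> 3, which passes divergence from f to g off
      0.\<close>
    have "(\<lambda>z. f k z / (z - 2)) holomorphic_on ball 0 1"
      by (intro holomorphic_intros hol) auto
    moreover have "f k z = (z - 2) * (f k z / (z - 2))" if "z \<in> ball 0 1" for z
      using that by auto
    ultimately show ?thesis
      using False by (intro exI [of _ 2] exI [of _ "\<lambda>z. f k z / (z - 2)"]) (simp add: P_def)
  qed
  then obtain a g where g: "\<And>k. g k holomorphic_on ball 0 1"
    and fg: "\<And>k z. z \<in> ball 0 1 \<Longrightarrow> f k z = (z - a k) * g k z"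
    and a2: "\<And>k. norm (a k) \<le> 2" and P: "\<And>k. P k (a k) (g k)"
    by metis
  have ev0: "\<forall>\<^sub>F k in sequentially. \<exists>z\<in>cball 0 (1/2). f k z = 0"
    by (rule eventually_zero_of_no_convergent_subseq [OF assms])
  have annulus: "\<forall>\<^sub>F k in sequentially. \<forall>z\<in>cball 0 (1/2) - ball 0 \<epsilon>. 3 \<le> norm (f k z)" if "0 < \<epsilon>" for \<epsilon> :: real
  proof -
    have "compact (cball 0 (1/2) - ball 0 \<epsilon> :: complex set) \<and> cball 0 (1/2) - ball 0 \<epsilon> \<subseteq> ball 0 1 - {0::complex}"
      using that by (auto intro!: compact_diff)
    then show ?thesis using div unfolding locally_divergent_seq_def by blast
  qed
  obtain \<epsilon> where \<epsilon>: "0 < \<epsilon>" "\<And>f a b. \<lbrakk>f \<in> radial_family; \<And>z. \<lbrakk>\<epsilon> \<le> norm z; norm z \<le> 1/2\<rbrakk> \<Longrightarrow> 3 \<le> norm (f z);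
      a \<in> cball 0 (1/2); b \<in> cball 0 (1/2); f a = 0; f b = 0\<rbrakk> \<Longrightarrow> a = b \<and> deriv f a \<noteq> 0"
    using radial_family_unique_zero by metis
  \<comment> \<open>A zero of g k in |z| \<le> 1/2 is a zero of f k, hence equal to
    \<open>a k\<close>; but g k has there the value of f k', which is not 0.\<close>
  have "\<forall>\<^sub>F k in sequentially. \<forall>z\<in>cball (0::complex) (1/2). g k z \<noteq> 0"
    using ev0 annulus [OF \<epsilon>(1)]
  proof eventually_elim
    case (elim k)
    have ak: "a k \<in> cball 0 (1/2)" "f k (a k) = 0" "g k (a k) = deriv (f k) (a k)"
      using P [of k] elim(1) by (auto simp: P_def)
    show ?case
    proof
      fix z :: complex assume z: "z \<in> cball 0 (1/2)"
      show "g k z \<noteq> 0"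
      proof
        assume "g k z = 0"
        moreover have "z \<in> ball 0 1" using z by simp
        ultimately have "f k z = 0" using fg by simp
        have *: "z = a k \<and> deriv (f k) z \<noteq> 0"
          by (rule \<epsilon>(2) [OF f_in _ z ak(1) \<open>f k z = 0\<close> ak(2)]) (use elim(2) in auto)
        then have "deriv (f k) (a k) \<noteq> 0" by blast
        then show False using ak(3) \<open>g k z = 0\<close> * by simp
      qed
    qed
  qed
  moreover have "locally_divergent_seq (ball 0 1 - {0}) g"
    unfolding locally_divergent_seq_def
  proof (intro allI impI)
    fix K :: "complex set" and B assume K: "compact K \<and> K \<subseteq> ball 0 1 - {0}"
    then have "\<forall>\<^sub>F k in sequentially. \<forall>z\<in>K. 3 * \<bar>B\<bar> \<le> norm (f k z)"
      using div unfolding locally_divergent_seq_def by blast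
    then show "\<forall>\<^sub>F k in sequentially. \<forall>z\<in>K. B \<le> norm (g k z)"
    proof eventually_elim
      case (elim k)
      show ?case
      proof
        fix z assume z: "z \<in> K"
        then have z1: "z \<in> ball 0 1" using K by blast
        have "norm (z - a k) \<le> 3" using norm_triangle_ineq4 [of z "a k"] a2 [of k] z1 by simp
        then have "norm (f k z) \<le> 3 * norm (g k z)"
          unfolding fg [OF z1] norm_mult by (intro mult_right_mono) auto
        moreover have "3 * \<bar>B\<bar> \<le> norm (f k z)" using elim z by blast
        ultimately show "B \<le> norm (g k z)" by linarith
      qed
    qed
  qed
  ultimately have g_div: "locally_divergent_seq (ball 0 1) g"
    by (intro locally_divergent_seq_fill_puncture g)
  have "a \<longlonglongrightarrow> 0"
  proof (rule tendstoI)
    \<comment> \<open>Eventually |f k| \<ge> 3 on e \<le> |z| \<le> 1/2, so the zero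
      \<open>a k\<close> has modulus below e.\<close>
    fix e :: real assume "0 < e"
    show "\<forall>\<^sub>F k in sequentially. dist (a k) 0 < e"
      using ev0 annulus [OF \<open>0 < e\<close>]
    proof eventually_elim
      case (elim k)
      have ak: "a k \<in> cball 0 (1/2)" "f k (a k) = 0"
        using P [of k] elim(1) by (auto simp: P_def)
      show ?case
      proof (rule ccontr)
        assume "\<not> dist (a k) 0 < e"
        then have "a k \<in> cball 0 (1/2) - ball 0 e" using ak(1) by (simp add: dist_commute)
        then have "3 \<le> norm (f k (a k))" using elim(2) by blast
        then show False using ak(2) by simp
      qed
    qed
  qed
  with g fg spherically_converges_on_Infty [OF g_div] show thesis by (rule that)
qed

theorem theorem1p2:
  shows "normal_on (ball 0 1 - {0}) radial_family \<and>
    (\<forall>f :: nat \<Rightarrow> complex \<Rightarrow> complex.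
       range f \<subseteq> radial_family \<and> \<not> has_convergent_subseq_on (ball 0 1) f \<longrightarrow>
       (\<exists>(a :: nat \<Rightarrow> complex) (g :: nat \<Rightarrow> complex \<Rightarrow> complex).
          (\<forall>k. g k holomorphic_on ball 0 1) \<and>
          (\<forall>k. \<forall>z \<in> ball 0 1. f k z = (z - a k) * g k z) \<and>
          spherically_converges_on (ball 0 1) g (\<lambda>_. Infty) \<and>
          a \<longlonglongrightarrow> 0))"
proof (intro conjI allI impI)
  fix f :: "nat \<Rightarrow> complex \<Rightarrow> complex"
  assume "range f \<subseteq> radial_family \<and> \<not> has_convergent_subseq_on (ball 0 1) f"
  then have f: "range f \<subseteq> radial_family" "\<not> has_convergent_subseq_on (ball 0 1) f" by simp_all
  obtain a g where *: "\<And>k. g k holomorphic_on ball 0 1"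
    "\<And>k z. z \<in> ball 0 1 \<Longrightarrow> f k z = (z - a k) * g k z"
    "spherically_converges_on (ball 0 1) g (\<lambda>_. Infty)" "a \<longlonglongrightarrow> 0"
    by (rule radial_family_no_convergent_subseq [OF f]) (rule that)
  show "\<exists>(a :: nat \<Rightarrow> complex) (g :: nat \<Rightarrow> complex \<Rightarrow> complex).
          (\<forall>k. g k holomorphic_on ball 0 1) \<and>
          (\<forall>k. \<forall>z \<in> ball 0 1. f k z = (z - a k) * g k z) \<and>
          spherically_converges_on (ball 0 1) g (\<lambda>_. Infty) \<and>
          a \<longlonglongrightarrow> 0"
    by (intro exI [of _ a] exI [of _ g] conjI allI ballI *)
qed (rule normal_on_radial_family)

end
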